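(* Consider $\mathbb R^2\times\mathbb R^3=\{(x,\pi)\}$ with the diagonal $S^1$ action $\theta\cdot(x,\pi)=(R_\theta x,R_\theta\pi)$. Let $$w_1=2(x_1\pi_2-x_2\pi_1),\qquad w_2=2(x_1\pi_1+x_2\pi_2),$$ and for $j_1\geq0$, $j_2\in\mathbb R$ let $M_{j_1,j_2}$ be the quotient by $S^1$ of the set of $(x,\pi)$ with $$(\pi_1^2+\pi_2^2+\pi_3^2)^{1/2}=j_1,\qquad -\tfrac12(x_1^2+x_2^2)-\pi_3=j_2 .$$ Then $M_{j_1,j_2}$ is nonempty if and only if $j_2\le j_1$, and in that case the map $(x,\pi)\mapsto(w_1,w_2,\pi_3)$ identifies $M_{j_1,j_2}$ with the subset of $\mathbb R^3$ given by $$w_1^2+w_2^2=8(\pi_3^2-j_1^2)(\pi_3+j_2),\qquad -j_1\le\pi_3\le\min(j_1,-j_2),$$ i.e. with the surface of revolution about the $\pi_3$-axis of $\bigl(8(\pi_3^2-j_1^2)(\pi_3+j_2)\bigr)^{1/2}$ over the finite interval where the cubic is nonnegative. Consequently: (i) $M_{j_1,j_2}$ is a point if $j_1=0$ or $j_2=j_1$; (ii) if $j_1>0$ and $j_2=-j_1$, it is a topological sphere with exactly one singularity, which is conical, located at $w_1=w_2=0$, $\pi_3=j_1$, with tangent cone $(w_1^2+w_2^2)^{1/2}=4\sqrt{j_1}\,(j_1-\pi_3)$; (iii) in all remaining cases with $j_2<j_1$ (that is $j_1>0$, $j_2<j_1$, $j_2\neq-j_1$) it is a smooth sphere.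
   Context: $R_\theta$ denotes counterclockwise rotation by angle $\theta$ of $\mathbb R^2$, acting on $\mathbb R^3$ as rotation about the third axis. The spaces $M_{j_1,j_2}$ are the symplectic reduced spaces, for the symmetry group $SO(3)\times S^1$, of the drift system on $\mathbb R^2\times T^*SO(3)$ with Hamiltonian $\frac12I_1(\pi_1^2+\pi_2^2)+\frac12I_2\pi_3^2+\kappa(\pi_1x_1+\pi_2x_2)+a\pi_3$, where $\pi$ is the left-trivialized momentum of $SO(3)$; $j_1$ and $j_2$ are the values of the two Casimirs. *)

theory Defs
  imports "HOL-Analysis.Analysis"
begin

section \<open>Smooth maps, submanifolds and singularities in Euclidean spaces\<close>

primrec Ck_on :: "nat \<Rightarrow> 'a::euclidean_space set \<Rightarrow> ('a \<Rightarrow> 'b::real_normed_vector) \<Rightarrow> bool" where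
  "Ck_on 0 U f \<longleftrightarrow> continuous_on U f"
| "Ck_on (Suc k) U f \<longleftrightarrow>
     (\<forall>x\<in>U. f differentiable (at x)) \<and>
     (\<forall>v. Ck_on k U (\<lambda>x. frechet_derivative f (at x) v))"

text \<open>Only meant for open \<^term>\<open>U\<close>, since the derivatives are taken in the ambient space.\<close>

definition smooth_on :: "'a::euclidean_space set \<Rightarrow> ('a \<Rightarrow> 'b::real_normed_vector) \<Rightarrow> bool" where
  "smooth_on U f \<longleftrightarrow> (\<forall>k. Ck_on k U f)"

text \<open>Smoothness at a point of a map defined on an arbitrary subset \<^term>\<open>A\<close>: local existence of a
  smooth ambient extension. On an embedded submanifold this is the usual notion.\<close>

definition smooth_within ::
    "'a::euclidean_space set \<Rightarrow> ('a \<Rightarrow> 'b::real_normed_vector) \<Rightarrow> 'a \<Rightarrow> bool" where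
  "smooth_within A f a \<longleftrightarrow>
     (\<exists>U F. open U \<and> a \<in> U \<and> smooth_on U F \<and> (\<forall>x\<in>A \<inter> U. F x = f x))"

definition smooth_diffeo ::
    "'a::euclidean_space set \<Rightarrow> 'a set \<Rightarrow> ('a \<Rightarrow> 'a) \<Rightarrow> bool" where
  "smooth_diffeo U V \<phi> \<longleftrightarrow>
     open U \<and> open V \<and> (\<exists>\<psi>. homeomorphism U V \<phi> \<psi> \<and> smooth_on U \<phi> \<and> smooth_on V \<psi>)"

definition diffeomorphic_sets :: "'a::euclidean_space set \<Rightarrow> 'b::euclidean_space set \<Rightarrow> bool" where
  "diffeomorphic_sets A B \<longleftrightarrow>
     (\<exists>\<phi> \<psi>. homeomorphism A B \<phi> \<psi> \<and>
        (\<forall>a\<in>A. smooth_within A \<phi> a) \<and> (\<forall>b\<in>B. smooth_within B \<psi> b))"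

text \<open>Existence of a slice chart: \<^term>\<open>S\<close> is, near \<^term>\<open>p\<close>, a smooth embedded
  \<^term>\<open>k\<close>-dimensional submanifold.\<close>

definition submanifold_at :: "nat \<Rightarrow> 'a::euclidean_space set \<Rightarrow> 'a \<Rightarrow> bool" where
  "submanifold_at k S p \<longleftrightarrow>
     (\<exists>U V \<phi> L. p \<in> U \<and> smooth_diffeo U V \<phi> \<and> subspace L \<and> dim L = k \<and> \<phi> ` (S \<inter> U) = L \<inter> V)"

definition singular_points :: "nat \<Rightarrow> 'a::euclidean_space set \<Rightarrow> 'a set" where
  "singular_points k S = {p \<in> S. \<not> submanifold_at k S p}"

text \<open>The tangent cone as a set of vectors, i.e. with apex at the origin.\<close>

definition tangent_cone :: "'a::euclidean_space set \<Rightarrow> 'a \<Rightarrow> 'a set" where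
  "tangent_cone S p =
     {v. \<exists>s t. (\<forall>n::nat. s n \<in> S \<and> 0 < (t n :: real)) \<and> s \<longlonglongrightarrow> p \<and>
            (\<lambda>n. t n *\<^sub>R (s n - p)) \<longlonglongrightarrow> v}"

text \<open>A singular point is conical if a local diffeomorphism of the ambient space, fixing the point,
  straightens the set to its tangent cone.\<close>

definition conical_singularity :: "nat \<Rightarrow> 'a::euclidean_space set \<Rightarrow> 'a \<Rightarrow> bool" where
  "conical_singularity k S p \<longleftrightarrow>
     p \<in> singular_points k S \<and>
     (\<exists>U V \<phi>. p \<in> U \<and> smooth_diffeo U V \<phi> \<and> \<phi> p = p \<and>
        \<phi> ` (S \<inter> U) = (+) p ` tangent_cone S p \<inter> V)"


section \<open>The circle action and the reduced spaces\<close>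

type_synonym phase = "(real^2) \<times> (real^3)"

definition rot2 :: "real \<Rightarrow> real^2 \<Rightarrow> real^2" where
  "rot2 \<theta> x = vector [cos \<theta> * x$1 - sin \<theta> * x$2, sin \<theta> * x$1 + cos \<theta> * x$2]"

definition rot3 :: "real \<Rightarrow> real^3 \<Rightarrow> real^3" where
  "rot3 \<theta> p = vector [cos \<theta> * p$1 - sin \<theta> * p$2, sin \<theta> * p$1 + cos \<theta> * p$2, p$3]"

definition circle_act :: "real \<Rightarrow> phase \<Rightarrow> phase" where
  "circle_act \<theta> z = (rot2 \<theta> (fst z), rot3 \<theta> (snd z))"

definition circle_orbit :: "phase \<Rightarrow> phase set" where
  "circle_orbit z = range (\<lambda>\<theta>. circle_act \<theta> z)"

definition level_set :: "real \<Rightarrow> real \<Rightarrow> phase set" where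
  "level_set j1 j2 =
     {(x, p). sqrt ((p$1)\<^sup>2 + (p$2)\<^sup>2 + (p$3)\<^sup>2) = j1 \<and>
              - (1/2) * ((x$1)\<^sup>2 + (x$2)\<^sup>2) - p$3 = j2}"

definition reduced_space :: "real \<Rightarrow> real \<Rightarrow> phase set set" where
  "reduced_space j1 j2 = circle_orbit ` level_set j1 j2"

definition reduced_topology :: "real \<Rightarrow> real \<Rightarrow> phase set topology" where
  "reduced_topology j1 j2 =
     topology (\<lambda>W. W \<subseteq> reduced_space j1 j2 \<and>
       openin (top_of_set (level_set j1 j2)) {z \<in> level_set j1 j2. circle_orbit z \<in> W})"

lemma openin_reduced_topology:
  "openin (reduced_topology j1 j2) W \<longleftrightarrow>
     W \<subseteq> reduced_space j1 j2 \<and>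
     openin (top_of_set (level_set j1 j2)) {z \<in> level_set j1 j2. circle_orbit z \<in> W}"
proof -
  let ?Z = "level_set j1 j2"
  let ?P = "\<lambda>W. W \<subseteq> reduced_space j1 j2 \<and> openin (top_of_set ?Z) {z \<in> ?Z. circle_orbit z \<in> W}"
  have "?P (S \<inter> T)" if "?P S" "?P T" for S T
  proof -
    have "{z \<in> ?Z. circle_orbit z \<in> S \<inter> T} =
        {z \<in> ?Z. circle_orbit z \<in> S} \<inter> {z \<in> ?Z. circle_orbit z \<in> T}" by auto
    with that show ?thesis by (simp add: openin_Int le_infI1)
  qed
  moreover have "?P (\<Union>\<K>)" if "\<forall>K\<in>\<K>. ?P K" for \<K>
  proof -
    have "{z \<in> ?Z. circle_orbit z \<in> \<Union>\<K>} = (\<Union>K\<in>\<K>. {z \<in> ?Z. circle_orbit z \<in> K})" by auto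
    moreover have "openin (top_of_set ?Z) (\<Union>K\<in>\<K>. {z \<in> ?Z. circle_orbit z \<in> K})"
      using that by (intro openin_Union) blast
    ultimately show ?thesis using that by (simp only: Sup_least simp_thms)
  qed
  ultimately have "istopology ?P"
    unfolding istopology_def by blast
  then show ?thesis
    unfolding reduced_topology_def by (simp add: topology_inverse')
qed

lemma topspace_reduced_topology: "topspace (reduced_topology j1 j2) = reduced_space j1 j2"
proof -
  have "{z \<in> level_set j1 j2. circle_orbit z \<in> reduced_space j1 j2} = level_set j1 j2"
    by (auto simp: reduced_space_def)
  then have "openin (reduced_topology j1 j2) (reduced_space j1 j2)"
    by (simp add: openin_reduced_topology)
  then show ?thesis
    by (meson openin_reduced_topology openin_subset openin_topspace subset_antisym)
qed

lemma quotient_map_circle_orbit: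
  "quotient_map (top_of_set (level_set j1 j2)) (reduced_topology j1 j2) circle_orbit"
  by (auto simp: quotient_map_def topspace_reduced_topology openin_reduced_topology reduced_space_def)

text \<open>The smooth structure of the quotient: a real function on the reduced space is smooth at an
  orbit if its pull-back to the level set is smooth at the points of that orbit. Where the action is
  free on a smooth level set this is the quotient manifold structure.\<close>

definition orbit_smooth :: "real \<Rightarrow> real \<Rightarrow> (phase set \<Rightarrow> real) \<Rightarrow> phase set \<Rightarrow> bool" where
  "orbit_smooth j1 j2 f m \<longleftrightarrow> (\<forall>z\<in>m. smooth_within (level_set j1 j2) (f \<circ> circle_orbit) z)"

text \<open>For a homeomorphism \<^term>\<open>\<Phi>\<close> from the reduced space onto \<^term>\<open>N\<close>: being a local
  diffeomorphism at \<^term>\<open>m\<close>, i.e. an isomorphism of germs of smooth functions.\<close>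

definition orbit_diffeo_at ::
    "real \<Rightarrow> real \<Rightarrow> (phase set \<Rightarrow> real^3) \<Rightarrow> (real^3) set \<Rightarrow> phase set \<Rightarrow> bool" where
  "orbit_diffeo_at j1 j2 \<Phi> N m \<longleftrightarrow>
     (\<forall>g :: real^3 \<Rightarrow> real. smooth_within N g (\<Phi> m) \<longleftrightarrow> orbit_smooth j1 j2 (g \<circ> \<Phi>) m)"


section \<open>Invariants and the surface\<close>

definition w1 :: "phase \<Rightarrow> real" where
  "w1 z = 2 * (fst z $ 1 * snd z $ 2 - fst z $ 2 * snd z $ 1)"

definition w2 :: "phase \<Rightarrow> real" where
  "w2 z = 2 * (fst z $ 1 * snd z $ 1 + fst z $ 2 * snd z $ 2)"

definition invariants :: "phase \<Rightarrow> real^3" where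
  "invariants z = vector [w1 z, w2 z, snd z $ 3]"

definition reduced_coords :: "phase set \<Rightarrow> real^3" where
  "reduced_coords m = the_elem (invariants ` m)"

definition cubic :: "real \<Rightarrow> real \<Rightarrow> real \<Rightarrow> real" where
  "cubic j1 j2 s = 8 * (s\<^sup>2 - j1\<^sup>2) * (s + j2)"

definition reduced_surface :: "real \<Rightarrow> real \<Rightarrow> (real^3) set" where
  "reduced_surface j1 j2 =
     {w. (w$1)\<^sup>2 + (w$2)\<^sup>2 = cubic j1 j2 (w$3) \<and> - j1 \<le> w$3 \<and> w$3 \<le> min j1 (- j2)}"

definition surface_of_revolution :: "(real \<Rightarrow> real) \<Rightarrow> real set \<Rightarrow> (real^3) set" where
  "surface_of_revolution r I =
     {vector [r s * cos \<theta>, r s * sin \<theta>, s] | s \<theta>. s \<in> I}"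

abbreviation unit_sphere :: "(real^3) set" where
  "unit_sphere \<equiv> sphere 0 1"

end

theory Submission
  imports Defs
begin

text \<open>
  Write \<open>x\<close> and \<open>q = (\<pi>\<^sub>1, \<pi>\<^sub>2)\<close> as complex numbers. The circle multiplies both by the same unit, so
  \<open>w\<^sub>2 + i w\<^sub>1\<close>, which is twice \<open>q\<close> times the conjugate of \<open>x\<close>, is invariant, as is \<open>\<pi>\<^sub>3\<close>. On the level
  set \<open>|x|\<^sup>2\<close> and \<open>|q|\<^sup>2\<close> are functions of \<open>\<pi>\<^sub>3\<close>; this gives the equation of the surface
  (\<open>invariants_reduced_surface\<close>) and shows that the invariants separate orbits
  (\<open>invariants_separate_orbits\<close>). Since the level set is compact, the reduced space is homeomorphic
  to its image. Where \<open>x \<noteq> 0\<close> or \<open>q \<noteq> 0\<close>, normalizing that vector to be real and positive gives a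
  smooth local section (\<open>local_section\<close>), through which invariant smooth functions descend to smooth
  functions on the surface (\<open>orbit_diffeo_reduced_coords\<close>).

  The cubic equals \<open>8 (s - a) (b - s) (c - s)\<close> with \<open>a = - j\<^sub>1\<close> and with \<open>b \<le> c\<close> the ordered values
  \<open>j\<^sub>1\<close> and \<open>- j\<^sub>2\<close>. If \<open>a < b\<close>, rescaling the radius by the square root of the factor \<open>2 (c - s)\<close>
  and the height affinely is a diffeomorphism of the half space below height \<open>c\<close> that takes the
  surface to the unit sphere (\<open>smooth_diffeo_to_sphere\<close>). For \<open>b < c\<close> this covers the entire surface,
  which is then a smooth sphere (\<open>smooth_case\<close>). For \<open>b = c\<close>, that is \<open>j\<^sub>2 = - j\<^sub>1\<close>, it covers all points except the top one;
  the inverse map still extends to a homeomorphism, and another rescaling of the radius, by a factor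
  equal to 1 at the apex, straightens the surface to its tangent cone
  (\<open>conical_singularity_pinched\<close>). The apex really is singular because the tangent cone of a
  submanifold of positive dimension contains a line (\<open>submanifold_at_tangent_line\<close>), while this one is one-sided.
\<close>

section \<open>Calculus of smooth maps\<close>

text \<open>The recursion defining \<^const>\<open>Ck_on\<close> differentiates the function that
  \<^const>\<open>frechet_derivative\<close> selects, so every closure property needs this
  congruence to replace it by a derivative computed by hand.\<close>

lemma Ck_on_cong:
  assumes "open U" "\<And>x. x \<in> U \<Longrightarrow> f x = g x" "Ck_on k U f"
  shows "Ck_on k U g"
  using assms(2,3)
proof (induction k arbitrary: f g)
  case 0
  then show ?case by (simp cong: continuous_on_cong)
next
  case (Suc k)
  have der: "(g has_derivative frechet_derivative f (at x)) (at x)" if "x \<in> U" for x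
  proof (rule has_derivative_transform_within_open[OF _ \<open>open U\<close> that])
    show "(f has_derivative frechet_derivative f (at x)) (at x)"
      using Suc.prems(2) that frechet_derivative_works by auto
  qed (use Suc.prems(1) in auto)
  have "Ck_on k U (\<lambda>x. frechet_derivative g (at x) v)" for v
    using Suc.IH[of "\<lambda>x. frechet_derivative f (at x) v" "\<lambda>x. frechet_derivative g (at x) v"]
      Suc.prems(2) der frechet_derivative_at by fastforce
  then show ?case using der by (auto simp: differentiable_def)
qed

lemma Ck_on_SucI:
  assumes "open U" "\<And>x. x \<in> U \<Longrightarrow> (f has_derivative f' x) (at x)"
    and "\<And>v. Ck_on k U (\<lambda>x. f' x v)"
  shows "Ck_on (Suc k) U f"
proof -
  have "Ck_on k U (\<lambda>x. frechet_derivative f (at x) v)" for v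
    by (rule Ck_on_cong[OF assms(1) _ assms(3)[of v]]) (metis assms(2) frechet_derivative_at)
  then show ?thesis using assms(2) by (auto simp: differentiable_def)
qed

lemma Ck_on_SucD:
  assumes "Ck_on (Suc k) U f"
  shows "Ck_on k U f"
  using assms
proof (induction k arbitrary: f)
  case 0
  then show ?case
    by (auto intro!: continuous_at_imp_continuous_on differentiable_imp_continuous_within)
next
  case (Suc k)
  then show ?case by (metis Ck_on.simps(2))
qed

lemma Ck_on_has_derivative:
  "Ck_on (Suc k) U f \<Longrightarrow> x \<in> U \<Longrightarrow> (f has_derivative frechet_derivative f (at x)) (at x)"
  using frechet_derivative_works by auto

lemma Ck_on_subset: "Ck_on k U f \<Longrightarrow> W \<subseteq> U \<Longrightarrow> Ck_on k W f"
  by (induction k arbitrary: f) (auto intro: continuous_on_subset)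

lemma Ck_on_const: "open U \<Longrightarrow> Ck_on k U (\<lambda>x. c)"
proof (induction k arbitrary: c)
  case (Suc k)
  show ?case by (rule Ck_on_SucI[where f' = "\<lambda>x v. 0"]) (use Suc in auto)
qed auto

lemma Ck_on_bounded_linear:
  assumes "bounded_linear L" "open U"
  shows "Ck_on k U L"
proof (cases k)
  case 0
  then show ?thesis using assms by (simp add: linear_continuous_on)
next
  case (Suc l)
  show ?thesis unfolding Suc
    by (rule Ck_on_SucI[where f' = "\<lambda>x. L"])
       (use assms in \<open>auto intro: bounded_linear.has_derivative Ck_on_const bounded_linear_imp_has_derivative\<close>)
qed

lemma Ck_on_linear_compose:
  assumes "bounded_linear L" "open U" "Ck_on k U f"
  shows "Ck_on k U (\<lambda>x. L (f x))"
  using assms(3)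
proof (induction k arbitrary: f)
  case 0
  then show ?case using assms(1) by (simp add: bounded_linear.continuous_on)
next
  case (Suc k)
  show ?case
    by (rule Ck_on_SucI[where f' = "\<lambda>x v. L (frechet_derivative f (at x) v)"])
       (use Suc assms Ck_on_has_derivative[OF Suc.prems] in \<open>auto intro: bounded_linear.has_derivative\<close>)
qed

lemma Ck_on_add:
  assumes "open U" "Ck_on k U f" "Ck_on k U g"
  shows "Ck_on k U (\<lambda>x. f x + g x)"
  using assms(2,3)
proof (induction k arbitrary: f g)
  case 0
  then show ?case by (simp add: continuous_on_add)
next
  case (Suc k)
  show ?case
    by (rule Ck_on_SucI[where f' = "\<lambda>x v. frechet_derivative f (at x) v + frechet_derivative g (at x) v"])
       (use Suc assms(1) Ck_on_has_derivative[OF Suc.prems(1)] Ck_on_has_derivative[OF Suc.prems(2)]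
         in \<open>auto intro: has_derivative_add\<close>)
qed

lemma (in bounded_bilinear) Ck_on_prod:
  assumes "open U" "Ck_on k U f" "Ck_on k U g"
  shows "Ck_on k U (\<lambda>x. prod (f x) (g x))"
  using assms(2,3)
proof (induction k arbitrary: f g)
  case 0
  then show ?case by (simp add: continuous_on)
next
  case (Suc k)
  show ?case
  proof (rule Ck_on_SucI[OF assms(1)])
    show "((\<lambda>x. prod (f x) (g x)) has_derivative
        (\<lambda>v. prod (f x) (frechet_derivative g (at x) v) + prod (frechet_derivative f (at x) v) (g x))) (at x)"
      if "x \<in> U" for x
      using that Suc.prems by (intro FDERIV Ck_on_has_derivative)
    show "Ck_on k U (\<lambda>x. prod (f x) (frechet_derivative g (at x) v) + prod (frechet_derivative f (at x) v) (g x))" for v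
      using Suc.prems[THEN Ck_on_SucD] Suc.prems by (intro Ck_on_add assms(1) Suc.IH) auto
  qed
qed

lemma Ck_on_sum:
  assumes "open U" "finite I" "\<And>i. i \<in> I \<Longrightarrow> Ck_on k U (f i)"
  shows "Ck_on k U (\<lambda>x. \<Sum>i\<in>I. f i x)"
  using assms(2,3) by (induction I) (auto intro: Ck_on_const Ck_on_add assms(1))

text \<open>Expanding the inner derivative in an orthonormal basis turns the chain rule into a finite
  sum of products of a \<open>C\<^sup>k\<close> function with a composition of \<open>C\<^sup>k\<close> functions, which is
  what the induction on \<open>k\<close> can handle.\<close>

lemma Ck_on_compose:
  fixes f :: "'a::euclidean_space \<Rightarrow> 'b::euclidean_space" and g :: "'b \<Rightarrow> 'c::real_normed_vector"
  assumes "open U" "open V" "f ` U \<subseteq> V" "Ck_on k U f" "Ck_on k V g"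
  shows "Ck_on k U (\<lambda>x. g (f x))"
  using assms(4,5)
proof (induction k arbitrary: g)
  case 0
  then show ?case using assms(3) by (auto intro: continuous_on_compose2)
next
  case (Suc k)
  let ?D = "\<lambda>x v. \<Sum>b\<in>Basis. (frechet_derivative f (at x) v \<bullet> b) *\<^sub>R frechet_derivative g (at (f x)) b"
  show ?case
  proof (rule Ck_on_SucI[where f' = ?D, OF assms(1)])
    fix x assume x: "x \<in> U"
    have g: "(g has_derivative frechet_derivative g (at (f x))) (at (f x))"
      using Suc.prems(2) assms(3) x by (intro Ck_on_has_derivative) auto
    have comp: "((\<lambda>x. g (f x)) has_derivative
       (\<lambda>v. frechet_derivative g (at (f x)) (frechet_derivative f (at x) v))) (at x)"
      using Suc.prems(1) x by (intro has_derivative_compose[where f = f and g = g, OF _ g] Ck_on_has_derivative)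
    have expand: "frechet_derivative g (at (f x)) y = (\<Sum>b\<in>Basis. (y \<bullet> b) *\<^sub>R frechet_derivative g (at (f x)) b)" for y
    proof -
      have l: "linear (frechet_derivative g (at (f x)))"
        using g has_derivative_linear by blast
      have "frechet_derivative g (at (f x)) y = frechet_derivative g (at (f x)) (\<Sum>b\<in>Basis. (y \<bullet> b) *\<^sub>R b)"
        by (simp add: euclidean_representation)
      also have "\<dots> = (\<Sum>b\<in>Basis. (y \<bullet> b) *\<^sub>R frechet_derivative g (at (f x)) b)"
        by (simp add: linear_sum[OF l] linear_scale[OF l])
      finally show ?thesis .
    qed
    show "((\<lambda>x. g (f x)) has_derivative ?D x) (at x)"
      by (rule has_derivative_eq_rhs[OF comp]) (rule ext, rule expand)
  next
    fix v
    show "Ck_on k U (\<lambda>x. ?D x v)"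
    proof (intro Ck_on_sum bounded_bilinear.Ck_on_prod[OF bounded_bilinear_scaleR] assms(1))
      fix b :: 'b
      show "Ck_on k U (\<lambda>x. frechet_derivative f (at x) v \<bullet> b)"
        using Suc.prems(1) by (intro Ck_on_linear_compose[OF bounded_linear_inner_left] assms(1)) auto
      show "Ck_on k U (\<lambda>x. frechet_derivative g (at (f x)) b)"
        using Ck_on_SucD[OF Suc.prems(1)] Suc.prems(2) by (intro Suc.IH) auto
    qed auto
  qed
qed

text \<open>Real powers are closed under differentiation up to constants, so one induction with the
  exponent generalized covers square roots and reciprocals of positive functions alike.\<close>

lemma Ck_on_powr: "Ck_on k {0<..} (\<lambda>x::real. x powr a)"
proof (induction k arbitrary: a)
  case 0
  show ?case by (auto intro!: continuous_intros)
next
  case (Suc k)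
  show ?case
  proof (rule Ck_on_SucI)
    show "((\<lambda>x. x powr a) has_derivative (*) (a * x powr (a - 1))) (at x)"
      if "x \<in> {0<..}" for x :: real
      using has_real_derivative_powr[of x a] that by (simp add: has_field_derivative_def)
    show "Ck_on k {0<..} (\<lambda>x::real. a * x powr (a - 1) * v)" for v
      using Ck_on_linear_compose[OF bounded_linear_mult_right[of "a * v"] open_greaterThan Suc[of "a - 1"]]
      by (simp add: mult.assoc mult.left_commute mult.commute[of v])
  qed simp
qed

named_theorems smooth_intros

lemma smooth_on_cong:
  assumes "open U" "smooth_on U f" "\<And>x. x \<in> U \<Longrightarrow> f x = g x"
  shows "smooth_on U g"
  using assms(2) Ck_on_cong[OF assms(1,3)] by (simp add: smooth_on_def)

lemma smooth_on_subset: "smooth_on U f \<Longrightarrow> W \<subseteq> U \<Longrightarrow> smooth_on W f"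
  by (metis smooth_on_def Ck_on_subset)

lemma smooth_on_imp_continuous_on: "smooth_on U f \<Longrightarrow> continuous_on U f"
  by (auto simp: smooth_on_def dest: spec[of _ 0])

lemma smooth_on_imp_differentiable: "smooth_on U f \<Longrightarrow> x \<in> U \<Longrightarrow> f differentiable (at x)"
  by (auto simp: smooth_on_def dest: spec[of _ 1])

lemma smooth_on_const[smooth_intros]: "open U \<Longrightarrow> smooth_on U (\<lambda>x. c)"
  by (simp add: smooth_on_def Ck_on_const)

lemma smooth_on_linear_compose:
  "bounded_linear L \<Longrightarrow> open U \<Longrightarrow> smooth_on U f \<Longrightarrow> smooth_on U (\<lambda>x. L (f x))"
  unfolding smooth_on_def by (blast intro: Ck_on_linear_compose)

lemma smooth_on_id[smooth_intros]: "open U \<Longrightarrow> smooth_on U (\<lambda>x. x)"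
  unfolding smooth_on_def using Ck_on_bounded_linear[OF bounded_linear_ident] by metis

lemmas smooth_on_linear_intros[smooth_intros] =
  smooth_on_linear_compose[OF bounded_linear_vec_nth]
  smooth_on_linear_compose[OF bounded_linear_fst]
  smooth_on_linear_compose[OF bounded_linear_snd]
  smooth_on_linear_compose[OF bounded_linear_minus[OF bounded_linear_ident]]

lemma smooth_on_add[smooth_intros]:
  "open U \<Longrightarrow> smooth_on U f \<Longrightarrow> smooth_on U g \<Longrightarrow> smooth_on U (\<lambda>x. f x + g x)"
  by (simp add: smooth_on_def Ck_on_add)

lemma smooth_on_diff[smooth_intros]:
  "open U \<Longrightarrow> smooth_on U f \<Longrightarrow> smooth_on U g \<Longrightarrow> smooth_on U (\<lambda>x. f x - g x)"
  using smooth_on_add[of U f "\<lambda>x. - g x"] smooth_on_linear_intros(4)[of U g] by simp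

lemma smooth_on_bilinear:
  "bounded_bilinear p \<Longrightarrow> open U \<Longrightarrow> smooth_on U f \<Longrightarrow> smooth_on U g \<Longrightarrow> smooth_on U (\<lambda>x. p (f x) (g x))"
  unfolding smooth_on_def by (blast intro: bounded_bilinear.Ck_on_prod)

lemmas smooth_on_bilinear_intros[smooth_intros] =
  smooth_on_bilinear[OF bounded_bilinear_mult]
  smooth_on_bilinear[OF bounded_bilinear_scaleR]
  smooth_on_bilinear[OF bounded_bilinear_inner]

lemma smooth_on_power2[smooth_intros]:
  fixes f :: "'a::euclidean_space \<Rightarrow> real"
  shows "open U \<Longrightarrow> smooth_on U f \<Longrightarrow> smooth_on U (\<lambda>x. (f x)\<^sup>2)"
  unfolding power2_eq_square by (intro smooth_intros)

lemma smooth_on_compose: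
  fixes f :: "'a::euclidean_space \<Rightarrow> 'b::euclidean_space"
  assumes "smooth_on V g" "smooth_on U f" "open U" "open V" "f ` U \<subseteq> V"
  shows "smooth_on U (\<lambda>x. g (f x))"
  using assms(1,2) Ck_on_compose[OF assms(3-5)] by (metis smooth_on_def)

lemma smooth_on_powr[smooth_intros]:
  fixes f :: "'a::euclidean_space \<Rightarrow> real"
  assumes "open U" "smooth_on U f" "\<And>x. x \<in> U \<Longrightarrow> f x > 0"
  shows "smooth_on U (\<lambda>x. f x powr a)"
  by (rule smooth_on_compose[of "{0<..}" "\<lambda>y. y powr a"])
     (use assms in \<open>auto simp: smooth_on_def Ck_on_powr\<close>)

lemma smooth_on_sqrt[smooth_intros]:
  fixes f :: "'a::euclidean_space \<Rightarrow> real"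
  assumes "open U" "smooth_on U f" "\<And>x. x \<in> U \<Longrightarrow> f x > 0"
  shows "smooth_on U (\<lambda>x. sqrt (f x))"
  by (rule smooth_on_cong[OF assms(1) smooth_on_powr[OF assms, of "1/2"]])
     (use assms in \<open>auto simp: powr_half_sqrt less_imp_le\<close>)

lemma smooth_on_divide[smooth_intros]:
  fixes f :: "'a::euclidean_space \<Rightarrow> real"
  assumes "open U" "smooth_on U f" "smooth_on U g" "\<And>x. x \<in> U \<Longrightarrow> g x > 0"
  shows "smooth_on U (\<lambda>x. f x / g x)"
proof (rule smooth_on_cong[OF assms(1)])
  show "smooth_on U (\<lambda>x. f x * g x powr (- 1))"
    using assms by (intro smooth_intros) auto
  show "f x * g x powr (- 1) = f x / g x" if "x \<in> U" for x
    using assms(4)[OF that] by (simp add: powr_minus_divide)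
qed

lemma smooth_on_Pair[smooth_intros]:
  assumes "open U" "smooth_on U f" "smooth_on U g"
  shows "smooth_on U (\<lambda>x. (f x, g x))"
proof -
  have "smooth_on U (\<lambda>x. (f x, 0))"
    by (rule smooth_on_linear_compose[OF bounded_linear_Pair[OF bounded_linear_ident bounded_linear_zero] assms(1,2)])
  moreover have "smooth_on U (\<lambda>x. (0, g x))"
    by (rule smooth_on_linear_compose[OF bounded_linear_Pair[OF bounded_linear_zero bounded_linear_ident] assms(1,3)])
  ultimately have "smooth_on U (\<lambda>x. (f x, 0) + (0, g x))"
    by (rule smooth_on_add[OF assms(1)])
  then show ?thesis by simp
qed

lemma smooth_on_vector3[smooth_intros]:
  fixes f g h :: "'a::euclidean_space \<Rightarrow> real"
  assumes "open U" "smooth_on U f" "smooth_on U g" "smooth_on U h"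
  shows "smooth_on U (\<lambda>x. vector [f x, g x, h x] :: real^3)"
proof -
  have v: "vector [a, b, c] = a *\<^sub>R axis 1 1 + b *\<^sub>R axis 2 1 + c *\<^sub>R (axis 3 1 :: real^3)" for a b c :: real
    by (simp add: vec_eq_iff forall_3 axis_def)
  show ?thesis unfolding v using assms by (intro smooth_intros)
qed

lemma smooth_on_vector2[smooth_intros]:
  fixes f g :: "'a::euclidean_space \<Rightarrow> real"
  assumes "open U" "smooth_on U f" "smooth_on U g"
  shows "smooth_on U (\<lambda>x. vector [f x, g x] :: real^2)"
proof -
  have v: "vector [a, b] = a *\<^sub>R axis 1 1 + b *\<^sub>R (axis 2 1 :: real^2)" for a b :: real
    by (simp add: vec_eq_iff forall_2 axis_def)
  show ?thesis unfolding v using assms by (intro smooth_intros)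
qed

section \<open>Diffeomorphisms, submanifolds and tangent cones\<close>

lemma smooth_within_cong_local:
  assumes "smooth_within A f a" "open W" "a \<in> W" "\<And>x. x \<in> A \<inter> W \<Longrightarrow> f x = g x"
  shows "smooth_within A g a"
proof -
  obtain U F where "open U" "a \<in> U" "smooth_on U F" "\<forall>x\<in>A \<inter> U. F x = f x"
    using assms(1) unfolding smooth_within_def by blast
  then show ?thesis
    unfolding smooth_within_def using assms(2-4)
    by (intro exI[of _ "U \<inter> W"] exI[of _ F]) (auto intro: smooth_on_subset)
qed

text \<open>The map \<open>f\<close> only has to send points of \<open>A\<close> near \<open>a\<close> into \<open>B\<close>: this is what allows the
  lemma to be applied to local sections and to charts defined on part of the space.\<close>

lemma smooth_within_compose:
  fixes f :: "'a::euclidean_space \<Rightarrow> 'b::euclidean_space"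
  assumes g: "smooth_within B g (f a)"
    and f: "open U" "a \<in> U" "smooth_on U f" "f ` (A \<inter> U) \<subseteq> B"
  shows "smooth_within A (g \<circ> f) a"
proof -
  obtain V G where V: "open V" "f a \<in> V" "smooth_on V G" "\<forall>x\<in>B \<inter> V. G x = g x"
    using g unfolding smooth_within_def by blast
  define W where "W = U \<inter> f -` V"
  have W: "open W"
    unfolding W_def using f(1,3) V(1)
    by (intro continuous_open_preimage smooth_on_imp_continuous_on)
  have "smooth_on W (\<lambda>x. G (f x))"
    by (rule smooth_on_compose[OF V(3) smooth_on_subset[OF f(3)] W V(1)]) (auto simp: W_def)
  then show ?thesis
    unfolding smooth_within_def using W f(2,4) V(2,4)
    by (intro exI[of _ W] exI[of _ "\<lambda>x. G (f x)"]) (auto simp: W_def)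
qed

lemma smooth_on_imp_within: "open U \<Longrightarrow> a \<in> U \<Longrightarrow> smooth_on U f \<Longrightarrow> smooth_within A f a"
  unfolding smooth_within_def by blast

lemma smooth_diffeo_restrict:
  assumes \<phi>: "smooth_diffeo U V \<phi>" and W: "open W" "W \<subseteq> U"
  shows "smooth_diffeo W (\<phi> ` W) \<phi>"
proof -
  obtain \<psi> where o: "open U" "open V" and h: "homeomorphism U V \<phi> \<psi>"
    and s: "smooth_on U \<phi>" "smooth_on V \<psi>"
    using \<phi> unfolding smooth_diffeo_def by blast
  have sub: "\<phi> ` W \<subseteq> V" using W h by (auto simp: homeomorphism_def)
  have "\<phi> ` W = V \<inter> \<psi> -` W"
    using h W(2) by (force simp: homeomorphism_def image_iff)
  then have "open (\<phi> ` W)"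
    using continuous_open_preimage[OF _ o(2) W(1)] h by (auto simp: homeomorphism_def)
  moreover have "homeomorphism W (\<phi> ` W) \<phi> \<psi>"
    using homeomorphism_of_subsets[OF h W(2) _ refl] sub by simp
  ultimately show ?thesis
    unfolding smooth_diffeo_def using W sub s smooth_on_subset by blast
qed

lemma smooth_diffeo_compose:
  assumes f: "smooth_diffeo U V f" and g: "smooth_diffeo V W g"
  shows "smooth_diffeo U W (g \<circ> f)"
proof -
  obtain f' g' where o: "open U" "open V" "open W"
    and h: "homeomorphism U V f f'" "homeomorphism V W g g'"
    and s: "smooth_on U f" "smooth_on V f'" "smooth_on V g" "smooth_on W g'"
    using f g unfolding smooth_diffeo_def by blast
  have "smooth_on U (g \<circ> f)" "smooth_on W (f' \<circ> g')"
    using smooth_on_compose[OF s(3,1) o(1,2)] smooth_on_compose[OF s(2,4) o(3,2)] h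
    by (auto simp: homeomorphism_def comp_def)
  then show ?thesis
    unfolding smooth_diffeo_def using o homeomorphism_compose[OF h] by blast
qed

text \<open>A slice chart for the image pulls back along \<open>\<Psi>\<close>, after both domains are shrunk to the
  region where the composition makes sense.\<close>

lemma submanifold_at_diffeo:
  assumes \<Psi>: "smooth_diffeo U V \<Psi>" "p \<in> U" "\<Psi> ` (S \<inter> U) = T \<inter> V"
    and T: "submanifold_at k T (\<Psi> p)"
  shows "submanifold_at k S p"
proof -
  obtain U' V' \<phi> L where c: "\<Psi> p \<in> U'" "smooth_diffeo U' V' \<phi>" "subspace L" "dim L = k"
    "\<phi> ` (T \<inter> U') = L \<inter> V'"
    using T unfolding submanifold_at_def by blast
  have o: "open U" "open V" "open U'" and inj: "inj_on \<Psi> U" "inj_on \<phi> U'" and im: "\<Psi> ` U = V" "\<phi> ` U' = V'"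
    and cont: "continuous_on U \<Psi>"
    using \<Psi>(1) c(2) unfolding smooth_diffeo_def homeomorphism_def by (auto intro: inj_on_inverseI)
  define W where "W = U \<inter> \<Psi> -` U'"
  have W: "open W" "W \<subseteq> U" unfolding W_def using continuous_open_preimage[OF cont o(1,3)] by auto
  have \<Psi>W: "\<Psi> ` W = V \<inter> U'" using im(1) by (auto simp: W_def)
  have "smooth_diffeo W (V \<inter> U') \<Psi>"
    using smooth_diffeo_restrict[OF \<Psi>(1) W] \<Psi>W by simp
  moreover have "smooth_diffeo (V \<inter> U') (\<phi> ` (V \<inter> U')) \<phi>"
    by (rule smooth_diffeo_restrict[OF c(2)]) (use o in auto)
  ultimately have d: "smooth_diffeo W (\<phi> ` (V \<inter> U')) (\<phi> \<circ> \<Psi>)"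
    by (rule smooth_diffeo_compose)
  have "\<Psi> ` (S \<inter> W) = \<Psi> ` (S \<inter> U) \<inter> U'"
    by (auto simp: W_def)
  then have "\<Psi> ` (S \<inter> W) = T \<inter> (V \<inter> U')"
    using \<Psi>(3) by (simp add: Int_ac)
  then have "(\<phi> \<circ> \<Psi>) ` (S \<inter> W) = \<phi> ` (T \<inter> (V \<inter> U'))"
    by (simp only: image_comp[symmetric])
  also have "\<dots> = \<phi> ` (T \<inter> U') \<inter> \<phi> ` (V \<inter> U')"
    using inj_on_image_Int[OF inj(2), of "T \<inter> U'" "V \<inter> U'"] by (simp add: Int_ac)
  also have "\<dots> = L \<inter> \<phi> ` (V \<inter> U')"
    using c(5) im(2) by blast
  finally have straight: "(\<phi> \<circ> \<Psi>) ` (S \<inter> W) = L \<inter> \<phi> ` (V \<inter> U')" .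
  have "p \<in> W" using c(1) \<Psi>(2) by (simp add: W_def)
  show ?thesis
    unfolding submanifold_at_def by (intro exI conjI; fact)
qed

text \<open>On the open half space facing \<open>p\<close> the sphere is the graph of the square root
  \<open>h\<close> over the unit ball of the hyperplane orthogonal to \<open>p\<close>; subtracting the graph function along \<open>p\<close>
  flattens it. The shear and its inverse are polynomial apart from that square root.\<close>

lemma sphere_submanifold_at:
  fixes p :: "'a::euclidean_space"
  assumes "p \<in> sphere 0 1"
  shows "submanifold_at (DIM('a) - 1) (sphere 0 1) p"
proof -
  define T where "T x = x - (x \<bullet> p) *\<^sub>R p" for x
  define h where "h x = sqrt (1 - T x \<bullet> T x)" for x
  define \<phi> where "\<phi> x = x - h x *\<^sub>R p" for x
  define \<psi> where "\<psi> y = y + h y *\<^sub>R p" for y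
  define U where "U = {x. T x \<bullet> T x < 1 \<and> 0 < x \<bullet> p}"
  define V where "V = {y. T y \<bullet> T y < 1 \<and> 0 < y \<bullet> p + h y}"
  define D where "D = {x. T x \<bullet> T x < 1}"
  define L where "L = {x. p \<bullet> x = 0}"
  have pp: "p \<bullet> p = 1" using assms by (simp add: dot_square_norm)
  have T_shift: "T (x + c *\<^sub>R p) = T x" "T (x - c *\<^sub>R p) = T x" for x c
    by (simp_all add: T_def algebra_simps pp)
  have TT: "T x \<bullet> T x = x \<bullet> x - (x \<bullet> p)\<^sup>2" for x
    by (simp add: T_def algebra_simps pp power2_eq_square inner_commute)
  have h_shift: "h (x + c *\<^sub>R p) = h x" "h (x - c *\<^sub>R p) = h x" for x c
    by (simp_all add: h_def T_shift)
  \<comment> \<open>the shears do not change \<open>T\<close>, so these identities hold on the whole space, even where the radicand is negative\<close>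
  have inv: "\<psi> (\<phi> x) = x" "\<phi> (\<psi> x) = x" for x
    by (simp_all add: \<phi>_def \<psi>_def h_shift)
  have contT: "continuous_on A T" for A unfolding T_def by (intro continuous_intros)
  have conth: "continuous_on A h" for A unfolding h_def by (intro continuous_intros contT)
  have oD: "open D" unfolding D_def by (intro open_Collect_less continuous_intros contT)
  have oU: "open U" unfolding U_def by (intro open_Collect_conj open_Collect_less continuous_intros contT)
  have oV: "open V" unfolding V_def by (intro open_Collect_conj open_Collect_less continuous_intros contT conth)
  have sT: "smooth_on D T" unfolding T_def using oD by (intro smooth_intros)
  have sh: "smooth_on D h" unfolding h_def using oD
    by (intro smooth_on_sqrt smooth_intros sT) (auto simp: D_def)
  have s: "smooth_on D \<phi>" "smooth_on D \<psi>" unfolding \<phi>_def \<psi>_def using oD by (intro smooth_intros sh; simp)+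
  have U_D: "U \<subseteq> D" "V \<subseteq> D" by (auto simp: U_def V_def D_def)
  have maps: "\<phi> x \<in> V \<longleftrightarrow> x \<in> U" for x
    by (auto simp: U_def V_def \<phi>_def T_shift h_shift inner_diff_left pp)
  have "homeomorphism U V \<phi> \<psi>"
    unfolding homeomorphism_def
    using maps inv s U_D by (auto simp: image_iff intro!: smooth_on_imp_continuous_on[OF smooth_on_subset]) (metis inv(2) maps)+
  then have diffeo: "smooth_diffeo U V \<phi>"
    unfolding smooth_diffeo_def using oU oV s U_D smooth_on_subset by blast
  have "p \<in> U" by (simp add: U_def T_def pp)
  have "\<phi> x \<in> L \<longleftrightarrow> x \<in> sphere 0 1" if "x \<in> U" for x
  proof -
    have "\<phi> x \<in> L \<longleftrightarrow> x \<bullet> p = h x" by (simp add: L_def \<phi>_def inner_diff_right pp inner_commute)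
    also have "\<dots> \<longleftrightarrow> (x \<bullet> p)\<^sup>2 = 1 - T x \<bullet> T x"
      using that unfolding h_def U_def by (metis (mono_tags, lifting) less_imp_le mem_Collect_eq real_sqrt_unique real_sqrt_pow2 diff_ge_0_iff_ge)
    also have "\<dots> \<longleftrightarrow> x \<in> sphere 0 1" by (auto simp: TT norm_eq_1)
    finally show ?thesis .
  qed
  then have "x \<in> \<phi> ` (sphere 0 1 \<inter> U) \<longleftrightarrow> x \<in> L \<inter> V" for x
    using inv maps[of "\<psi> x"] maps by (metis IntD1 IntD2 IntI imageE imageI)
  then have "\<phi> ` (sphere 0 1 \<inter> U) = L \<inter> V" by blast
  moreover have "subspace L" "dim L = DIM('a) - 1"
    unfolding L_def using dim_hyperplane[of p] pp by (force simp: subspace_hyperplane)+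
  ultimately show ?thesis
    unfolding submanifold_at_def
    by (intro exI[of _ U] exI[of _ V] exI[of _ \<phi>] exI[of _ L] conjI diffeo \<open>p \<in> U\<close>)
qed

text \<open>The tangent cone of a submanifold contains a linear space of the same dimension, hence a whole
  line in positive dimension. This is the obstruction that excludes a one-sided cone: straight
  lines through the chart image of \<open>p\<close>, run in both directions, are pulled back to curves
  in \<open>S\<close> with opposite velocities.\<close>

lemma submanifold_at_tangent_line:
  assumes "submanifold_at k S p" "p \<in> S" "k > 0"
  obtains v where "v \<noteq> 0" "v \<in> tangent_cone S p" "- v \<in> tangent_cone S p"
proof -
  obtain U V \<phi> L where c: "p \<in> U" "smooth_diffeo U V \<phi>" "subspace L" "dim L = k"
    "\<phi> ` (S \<inter> U) = L \<inter> V"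
    using assms(1) unfolding submanifold_at_def by blast
  obtain \<psi> where o: "open U" "open V" and hom: "homeomorphism U V \<phi> \<psi>" and s: "smooth_on U \<phi>" "smooth_on V \<psi>"
    using c(2) unfolding smooth_diffeo_def by blast
  define q where "q = \<phi> p"
  have q: "q \<in> L" "q \<in> V" "\<psi> q = p"
    using c assms(2) hom unfolding q_def by (auto simp: homeomorphism_def)
  obtain l where l: "l \<in> L" "l \<noteq> 0"
    using c(4) assms(3) by (metis dim_eq_0 subset_eq singletonI gr_implies_not0)
  obtain \<psi>' \<phi>' where d: "(\<psi> has_derivative \<psi>') (at q)" "(\<phi> has_derivative \<phi>') (at p)"
    using smooth_on_imp_differentiable s q c(1) unfolding differentiable_def by blast
  have "((\<lambda>x. \<phi> (\<psi> x)) has_derivative (\<lambda>v. \<phi>' (\<psi>' v))) (at q)"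
    by (rule has_derivative_compose[OF d(1)]) (use d(2) q in simp)
  moreover have "((\<lambda>x. \<phi> (\<psi> x)) has_derivative (\<lambda>v. v)) (at q)"
    by (rule has_derivative_transform_within_open[OF has_derivative_ident o(2) q(2)])
       (use hom in \<open>auto simp: homeomorphism_def\<close>)
  ultimately have inv: "\<phi>' (\<psi>' v) = v" for v
    by (metis has_derivative_unique)
  have lin: "linear \<phi>'" "linear \<psi>'" using d has_derivative_linear by blast+
  have key: "\<psi>' m \<in> tangent_cone S p" if m: "m \<in> L" for m
  proof -
    have "((\<lambda>t. \<psi> (q + t *\<^sub>R m)) has_derivative (\<lambda>t. \<psi>' (t *\<^sub>R m))) (at 0)"
      by (rule has_derivative_compose[where f = "\<lambda>t. q + t *\<^sub>R m"])
         (use d(1) in \<open>auto intro!: derivative_eq_intros\<close>)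
    then have "((\<lambda>t. \<psi> (q + t *\<^sub>R m)) has_vector_derivative \<psi>' m) (at 0)"
      by (simp add: has_vector_derivative_def linear_scale[OF lin(2)])
    then have lim: "(\<lambda>t. norm (\<psi> (q + t *\<^sub>R m) - p - t *\<^sub>R \<psi>' m) / norm t) \<midarrow>0\<rightarrow> 0"
      using q(3) by (simp add: has_vector_derivative_def has_derivative_at)
    \<comment> \<open>the difference quotients along \<open>t = 1 / (n + 1)\<close>, later shifted so that all points lie in the chart\<close>
    define h where "h n = inverse (real (Suc n))" for n
    have h_pos: "h n > 0" for n by (simp add: h_def)
    have h0: "h \<longlonglongrightarrow> 0" unfolding h_def by (rule LIMSEQ_inverse_real_of_nat)
    have "(\<lambda>n. norm (\<psi> (q + h n *\<^sub>R m) - p - h n *\<^sub>R \<psi>' m) / norm (h n)) \<longlonglongrightarrow> 0"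
      using lim h0 h_pos by (intro filterlim_compose[OF lim]) (auto simp: filterlim_at eventually_sequentially less_imp_neq[symmetric])
    also have "(\<lambda>n. norm (\<psi> (q + h n *\<^sub>R m) - p - h n *\<^sub>R \<psi>' m) / norm (h n)) =
        (\<lambda>n. norm (inverse (h n) *\<^sub>R (\<psi> (q + h n *\<^sub>R m) - p) - \<psi>' m))"
    proof
      fix n
      have "inverse (h n) *\<^sub>R (\<psi> (q + h n *\<^sub>R m) - p) - \<psi>' m =
          inverse (h n) *\<^sub>R (\<psi> (q + h n *\<^sub>R m) - p - h n *\<^sub>R \<psi>' m)"
        using h_pos[of n] by (simp add: scaleR_diff_right)
      then show "norm (\<psi> (q + h n *\<^sub>R m) - p - h n *\<^sub>R \<psi>' m) / norm (h n) =
        norm (inverse (h n) *\<^sub>R (\<psi> (q + h n *\<^sub>R m) - p) - \<psi>' m)"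
        using h_pos[of n] by (simp add: divide_inverse mult.commute)
    qed
    finally have quot: "(\<lambda>n. inverse (h n) *\<^sub>R (\<psi> (q + h n *\<^sub>R m) - p)) \<longlonglongrightarrow> \<psi>' m"
      using Lim_null tendsto_norm_zero_iff by blast
    have line: "(\<lambda>n. q + h n *\<^sub>R m) \<longlonglongrightarrow> q"
      using tendsto_add[OF tendsto_const tendsto_scaleR[OF h0 tendsto_const], of q m] by simp
    have "isCont \<psi> q"
      using d(1) has_derivative_continuous by blast
    then have curve: "(\<lambda>n. \<psi> (q + h n *\<^sub>R m)) \<longlonglongrightarrow> p"
      using isCont_tendsto_compose[OF _ line] q(3) by metis
    obtain N where N: "\<And>n. n \<ge> N \<Longrightarrow> q + h n *\<^sub>R m \<in> V"
      using topological_tendstoD[OF line o(2) q(2)] by (auto simp: eventually_sequentially)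
    have "\<psi> (q + h (n + N) *\<^sub>R m) \<in> S" for n
    proof -
      have "q + h (n + N) *\<^sub>R m \<in> L \<inter> V"
        using N[of "n + N"] m q(1) c(3) by (simp add: subspace_add subspace_scale)
      then have "q + h (n + N) *\<^sub>R m \<in> \<phi> ` (S \<inter> U)" using c(5) by simp
      then show ?thesis using hom by (auto simp: homeomorphism_def)
    qed
    then show ?thesis
      unfolding tangent_cone_def
      using h_pos LIMSEQ_ignore_initial_segment[OF quot, of N] LIMSEQ_ignore_initial_segment[OF curve, of N]
      by (intro CollectI exI[of _ "\<lambda>n. \<psi> (q + h (n + N) *\<^sub>R m)"] exI[of _ "\<lambda>n. inverse (h (n + N))"]) auto
  qed
  show ?thesis
  proof
    show "\<psi>' l \<noteq> 0" using inv[of l] l(2) lin(1) by (metis linear_0)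
    show "\<psi>' l \<in> tangent_cone S p" using key l by simp
    show "- \<psi>' l \<in> tangent_cone S p"
      using key[of "- l"] l c(3) lin(2) by (metis linear_neg subspace_neg)
  qed
qed

section \<open>Invariants of the circle action\<close>

lemma vec3_eqI: "a $ 1 = b $ 1 \<Longrightarrow> a $ 2 = b $ 2 \<Longrightarrow> a $ 3 = b $ 3 \<Longrightarrow> a = (b :: real^3)"
  by (simp add: vec_eq_iff forall_3)

lemma invariants_nth:
  "invariants z $ 1 = w1 z" "invariants z $ 2 = w2 z" "invariants z $ 3 = snd z $ 3"
  by (simp_all add: invariants_def)

lemma circle_act_nth:
  "fst (circle_act \<theta> z) $ 1 = cos \<theta> * fst z $ 1 - sin \<theta> * fst z $ 2"
  "fst (circle_act \<theta> z) $ 2 = sin \<theta> * fst z $ 1 + cos \<theta> * fst z $ 2"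
  "snd (circle_act \<theta> z) $ 1 = cos \<theta> * snd z $ 1 - sin \<theta> * snd z $ 2"
  "snd (circle_act \<theta> z) $ 2 = sin \<theta> * snd z $ 1 + cos \<theta> * snd z $ 2"
  "snd (circle_act \<theta> z) $ 3 = snd z $ 3"
  by (simp_all add: circle_act_def rot2_def rot3_def)

lemma phase_eqI:
  "fst z $ 1 = fst z' $ 1 \<Longrightarrow> fst z $ 2 = fst z' $ 2 \<Longrightarrow> snd z $ 1 = snd z' $ 1 \<Longrightarrow>
    snd z $ 2 = snd z' $ 2 \<Longrightarrow> snd z $ 3 = snd z' $ 3 \<Longrightarrow> z = (z' :: phase)"
  by (simp add: prod_eq_iff vec_eq_iff forall_2 forall_3)

lemma level_set_iff:
  assumes "j1 \<ge> 0"
  shows "z \<in> level_set j1 j2 \<longleftrightarrow>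
    (snd z $ 1)\<^sup>2 + (snd z $ 2)\<^sup>2 = j1\<^sup>2 - (snd z $ 3)\<^sup>2 \<and>
    (fst z $ 1)\<^sup>2 + (fst z $ 2)\<^sup>2 = - 2 * (j2 + snd z $ 3)"
proof -
  have "sqrt q = j1 \<longleftrightarrow> q = j1\<^sup>2" for q
    using assms by (metis real_sqrt_unique real_sqrt_abs abs_of_nonneg real_sqrt_eq_iff)
  then show ?thesis
    by (auto simp: level_set_def case_prod_beta field_simps)
qed

lemma cos_sin_one: "cos \<theta> * cos \<theta> + sin \<theta> * sin \<theta> = (1::real)"
  using sin_cos_squared_add3 by (simp add: add.commute)

text \<open>Writing \<open>\<real>\<^sup>2\<close> as \<open>\<complex>\<close>, these are the real and imaginary parts of the rotation invariant product
  of one vector with the conjugate of another.\<close>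

lemma rotation_products:
  fixes a b c d \<theta> :: real
  shows "(cos \<theta> * a - sin \<theta> * b) * (cos \<theta> * c - sin \<theta> * d) + (sin \<theta> * a + cos \<theta> * b) * (sin \<theta> * c + cos \<theta> * d) = a * c + b * d"
    and "(cos \<theta> * a - sin \<theta> * b) * (sin \<theta> * c + cos \<theta> * d) - (sin \<theta> * a + cos \<theta> * b) * (cos \<theta> * c - sin \<theta> * d) = a * d - b * c"
  using cos_sin_one[of \<theta>] by algebra+

lemma invariants_circle_act: "invariants (circle_act \<theta> z) = invariants z"
  by (rule vec3_eqI)
    (simp_all only: invariants_nth w1_def w2_def circle_act_nth rotation_products)

lemma circle_act_level_set:
  assumes "j1 \<ge> 0" "z \<in> level_set j1 j2"
  shows "circle_act \<theta> z \<in> level_set j1 j2"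
  using assms by (simp add: level_set_iff circle_act_nth rotation_products power2_eq_square)

lemma circle_act_0: "circle_act 0 z = z"
  by (rule phase_eqI) (simp_all add: circle_act_nth)

lemma circle_act_add: "circle_act \<theta> (circle_act \<eta> z) = circle_act (\<theta> + \<eta>) z"
  by (rule phase_eqI) (simp_all add: circle_act_nth cos_add sin_add algebra_simps)

lemma circle_orbit_refl: "z \<in> circle_orbit z"
  unfolding circle_orbit_def by (metis circle_act_0 rangeI)

lemma circle_orbit_circle_act: "circle_orbit (circle_act \<theta> z) = circle_orbit z"
proof -
  have "range (\<lambda>\<eta>. circle_act \<eta> (circle_act \<theta> z)) = (\<lambda>\<eta>. circle_act \<eta> z) ` range (\<lambda>\<eta>. \<eta> + \<theta>)"
    by (simp only: circle_act_add image_image)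
  moreover have "range (\<lambda>\<eta>. \<eta> + \<theta>) = UNIV"
    by (rule surjI[of _ "\<lambda>\<eta>. \<eta> - \<theta>"]) simp
  ultimately show ?thesis
    by (simp add: circle_orbit_def)
qed

lemma reduced_coords_orbit: "reduced_coords (circle_orbit z) = invariants z"
proof -
  have "invariants ` circle_orbit z = {invariants z}"
    by (simp add: circle_orbit_def image_image invariants_circle_act)
  then show ?thesis by (simp add: reduced_coords_def)
qed

text \<open>With \<open>x\<close> and \<open>q = (\<pi>\<^sub>1, \<pi>\<^sub>2)\<close> as complex numbers, \<open>w\<^sub>2 + i w\<^sub>1\<close> is twice the product of \<open>q\<close> with
  the conjugate of \<open>x\<close>. Hence \<open>w\<^sub>1\<^sup>2 + w\<^sub>2\<^sup>2 = 4 |x|\<^sup>2 |q|\<^sup>2\<close>, and on the level set both factors are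
  functions of \<open>\<pi>\<^sub>3\<close>.\<close>

lemma invariants_reduced_surface:
  assumes "j1 \<ge> 0" "z \<in> level_set j1 j2"
  shows "invariants z \<in> reduced_surface j1 j2"
proof -
  have q: "(snd z $ 1)\<^sup>2 + (snd z $ 2)\<^sup>2 = j1\<^sup>2 - (snd z $ 3)\<^sup>2"
    and x: "(fst z $ 1)\<^sup>2 + (fst z $ 2)\<^sup>2 = - 2 * (j2 + snd z $ 3)"
    using assms by (auto simp: level_set_iff)
  have "(w1 z)\<^sup>2 + (w2 z)\<^sup>2 = 4 * ((fst z $ 1)\<^sup>2 + (fst z $ 2)\<^sup>2) * ((snd z $ 1)\<^sup>2 + (snd z $ 2)\<^sup>2)"
    by (simp add: w1_def w2_def power2_eq_square algebra_simps)
  also have "\<dots> = cubic j1 j2 (snd z $ 3)"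
    unfolding x q by (simp add: cubic_def algebra_simps)
  finally have "(w1 z)\<^sup>2 + (w2 z)\<^sup>2 = cubic j1 j2 (snd z $ 3)" .
  moreover have "(snd z $ 3)\<^sup>2 \<le> j1\<^sup>2" "j2 + snd z $ 3 \<le> 0"
    using q x by (smt (verit) zero_le_power2)+
  ultimately show ?thesis
    using assms(1) power2_le_iff_abs_le[of j1 "snd z $ 3"]
    by (auto simp: reduced_surface_def invariants_nth)
qed

text \<open>The angle is the argument of the complex quotient of \<open>c + i d\<close> by \<open>a + i b\<close>.\<close>

lemma rotation_exists:
  fixes a b c d :: real
  assumes "a\<^sup>2 + b\<^sup>2 = c\<^sup>2 + d\<^sup>2"
  obtains \<theta> where "cos \<theta> * a - sin \<theta> * b = c" "sin \<theta> * a + cos \<theta> * b = d"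
proof (cases "a\<^sup>2 + b\<^sup>2 = 0")
  case True
  then have "a = 0" "b = 0" "c = 0" "d = 0" using assms by (auto simp: sum_power2_eq_zero_iff)
  then show ?thesis using that by simp
next
  case False
  define r where "r = a\<^sup>2 + b\<^sup>2"
  have r: "r \<noteq> 0" using False r_def by simp
  have "(a * c + b * d)\<^sup>2 + (a * d - b * c)\<^sup>2 = (a\<^sup>2 + b\<^sup>2) * (c\<^sup>2 + d\<^sup>2)"
    by (simp add: power2_eq_square algebra_simps)
  also have "\<dots> = r\<^sup>2" using assms by (simp add: r_def power2_eq_square)
  finally have "((a * c + b * d) / r)\<^sup>2 + ((a * d - b * c) / r)\<^sup>2 = 1"
    using r by (simp add: power_divide add_divide_distrib[symmetric])
  then obtain \<theta> where \<theta>: "(a * c + b * d) / r = cos \<theta>" "(a * d - b * c) / r = sin \<theta>"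
    using sincos_total_2pi by blast
  have "(a * c + b * d) * a - (a * d - b * c) * b = c * r" "(a * d - b * c) * a + (a * c + b * d) * b = d * r"
    by (simp_all add: r_def power2_eq_square algebra_simps)
  then have "((a * c + b * d) * a - (a * d - b * c) * b) / r = c" "((a * d - b * c) * a + (a * c + b * d) * b) / r = d"
    using r by simp_all
  then have "(a * c + b * d) / r * a - (a * d - b * c) / r * b = c" "(a * d - b * c) / r * a + (a * c + b * d) / r * b = d"
    by (simp_all add: add_divide_distrib diff_divide_distrib algebra_simps)
  then show ?thesis unfolding \<theta> by (rule that)
qed

text \<open>The norms of \<open>x\<close> and of \<open>(\<pi>\<^sub>1, \<pi>\<^sub>2)\<close> are determined by \<open>\<pi>\<^sub>3\<close>. If \<open>x \<noteq> 0\<close>, a rotation matches the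
  \<open>x\<close> components, after which \<open>w\<^sub>1\<close> and \<open>w\<^sub>2\<close> determine the rest; if \<open>x = 0\<close>, a rotation matches the
  horizontal momenta.\<close>

lemma invariants_separate_orbits:
  assumes "j1 \<ge> 0" "z \<in> level_set j1 j2" "z' \<in> level_set j1 j2" "invariants z = invariants z'"
  shows "circle_orbit z = circle_orbit z'"
proof -
  have s: "snd z $ 3 = snd z' $ 3" and w: "w1 z = w1 z'" "w2 z = w2 z'"
    using assms(4) by (metis invariants_nth)+
  have x: "(fst z $ 1)\<^sup>2 + (fst z $ 2)\<^sup>2 = (fst z' $ 1)\<^sup>2 + (fst z' $ 2)\<^sup>2"
    and q: "(snd z $ 1)\<^sup>2 + (snd z $ 2)\<^sup>2 = (snd z' $ 1)\<^sup>2 + (snd z' $ 2)\<^sup>2"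
    using assms s by (auto simp: level_set_iff)
  have "\<exists>\<theta>. circle_act \<theta> z = z'"
  proof (cases "fst z' $ 1 = 0 \<and> fst z' $ 2 = 0")
    case True
    then have x0: "fst z $ 1 = 0" "fst z $ 2 = 0" using x by (auto simp: sum_power2_eq_zero_iff)
    obtain \<theta> where "cos \<theta> * snd z $ 1 - sin \<theta> * snd z $ 2 = snd z' $ 1"
        "sin \<theta> * snd z $ 1 + cos \<theta> * snd z $ 2 = snd z' $ 2"
      using rotation_exists[OF q] by blast
    then have "circle_act \<theta> z = z'" using True x0 s by (intro phase_eqI) (simp_all add: circle_act_nth)
    then show ?thesis ..
  next
    case False
    obtain \<theta> where \<theta>: "cos \<theta> * fst z $ 1 - sin \<theta> * fst z $ 2 = fst z' $ 1"
        "sin \<theta> * fst z $ 1 + cos \<theta> * fst z $ 2 = fst z' $ 2"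
      using rotation_exists[OF x] by blast
    define y where "y = circle_act \<theta> z"
    have yx: "fst y $ 1 = fst z' $ 1" "fst y $ 2 = fst z' $ 2" using \<theta> by (simp_all add: y_def circle_act_nth)
    have "invariants y = invariants z'" using assms(4) by (simp add: y_def invariants_circle_act)
    then have "w1 y = w1 z'" "w2 y = w2 z'" by (metis invariants_nth)+
    \<comment> \<open>with \<open>x\<close> fixed, the invariants \<open>w1\<close>, \<open>w2\<close> are linear in the horizontal momentum, with determinant \<open>|x|\<^sup>2\<close>\<close>
    then have lin: "fst z' $ 1 * (snd y $ 2 - snd z' $ 2) - fst z' $ 2 * (snd y $ 1 - snd z' $ 1) = 0"
        "fst z' $ 1 * (snd y $ 1 - snd z' $ 1) + fst z' $ 2 * (snd y $ 2 - snd z' $ 2) = 0"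
      by (simp_all add: w1_def w2_def yx algebra_simps)
    have "((fst z' $ 1)\<^sup>2 + (fst z' $ 2)\<^sup>2) * (snd y $ 1 - snd z' $ 1) = 0"
      "((fst z' $ 1)\<^sup>2 + (fst z' $ 2)\<^sup>2) * (snd y $ 2 - snd z' $ 2) = 0"
      using lin by algebra+
    then have "snd y $ 1 = snd z' $ 1" "snd y $ 2 = snd z' $ 2"
      using False by (auto simp: sum_power2_eq_zero_iff)
    then have "y = z'" using yx s by (intro phase_eqI) (simp_all add: y_def circle_act_nth)
    then show ?thesis using y_def by blast
  qed
  then show ?thesis by (metis circle_orbit_circle_act)
qed

section \<open>Local sections of the orbit map\<close>

lemma smooth_on_invariants: "smooth_on UNIV invariants"
  unfolding invariants_def w1_def w2_def by (intro smooth_intros open_UNIV)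

lemma circle_orbit_singleton:
  assumes "fst z = 0" "snd z $ 1 = 0" "snd z $ 2 = 0"
  shows "is_singleton (circle_orbit z)"
proof -
  have "circle_act \<theta> z = z" for \<theta>
    by (rule phase_eqI) (simp_all add: circle_act_nth assms)
  then show ?thesis by (simp add: circle_orbit_def is_singleton_def)
qed

text \<open>Each orbit with \<open>x \<noteq> 0\<close> has exactly one point where \<open>x\<close> is on the positive first axis; solving for
  that point gives a section of the quotient map. The next definition does the same with
  \<open>(\<pi>\<^sub>1, \<pi>\<^sub>2)\<close> in place of \<open>x\<close>.\<close>

definition section_x :: "real \<Rightarrow> real^3 \<Rightarrow> phase" where
  "section_x j2 w = (let r = sqrt (- 2 * (j2 + w $ 3)) in
     (vector [r, 0], vector [w $ 2 / (2 * r), w $ 1 / (2 * r), w $ 3]))"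

definition section_p :: "real \<Rightarrow> real^3 \<Rightarrow> phase" where
  "section_p j1 w = (let t = sqrt (j1\<^sup>2 - (w $ 3)\<^sup>2) in
     (vector [w $ 2 / (2 * t), - (w $ 1 / (2 * t))], vector [t, 0, w $ 3]))"

lemma reduced_surfaceD:
  assumes "w \<in> reduced_surface j1 j2"
  shows "(w $ 1)\<^sup>2 + (w $ 2)\<^sup>2 = cubic j1 j2 (w $ 3)" "\<bar>w $ 3\<bar> \<le> j1" "j2 + w $ 3 \<le> 0"
  using assms by (auto simp: reduced_surface_def)

lemma section_x:
  assumes "j1 \<ge> 0" "w \<in> reduced_surface j1 j2" "j2 + w $ 3 < 0"
  shows "section_x j2 w \<in> level_set j1 j2" "invariants (section_x j2 w) = w"
proof -
  define r where "r = sqrt (- 2 * (j2 + w $ 3))"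
  have sec: "section_x j2 w = (vector [r, 0], vector [w $ 2 / (2 * r), w $ 1 / (2 * r), w $ 3])"
    by (simp only: section_x_def r_def Let_def)
  have r: "r > 0" "r\<^sup>2 = - 2 * (j2 + w $ 3)" using assms(3) by (simp_all add: r_def)
  have "(w $ 2 / (2 * r))\<^sup>2 + (w $ 1 / (2 * r))\<^sup>2 = cubic j1 j2 (w $ 3) / (4 * r\<^sup>2)"
    using reduced_surfaceD(1)[OF assms(2)]
    by (simp add: power_divide power_mult_distrib add_divide_distrib[symmetric] add.commute)
  also have "\<dots> = j1\<^sup>2 - (w $ 3)\<^sup>2"
    unfolding r(2) using assms(3) by (simp add: cubic_def field_simps)
  finally show "section_x j2 w \<in> level_set j1 j2"
    using r by (simp add: level_set_iff[OF assms(1)] sec)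
  show "invariants (section_x j2 w) = w"
    using r(1) by (intro vec3_eqI) (simp_all add: invariants_nth w1_def w2_def sec)
qed

lemma section_p:
  assumes "j1 \<ge> 0" "w \<in> reduced_surface j1 j2" "(w $ 3)\<^sup>2 < j1\<^sup>2"
  shows "section_p j1 w \<in> level_set j1 j2" "invariants (section_p j1 w) = w"
proof -
  define t where "t = sqrt (j1\<^sup>2 - (w $ 3)\<^sup>2)"
  have sec: "section_p j1 w = (vector [w $ 2 / (2 * t), - (w $ 1 / (2 * t))], vector [t, 0, w $ 3])"
    by (simp only: section_p_def t_def Let_def)
  have t: "t > 0" "t\<^sup>2 = j1\<^sup>2 - (w $ 3)\<^sup>2" using assms(3) by (simp_all add: t_def)
  have "(w $ 2 / (2 * t))\<^sup>2 + (w $ 1 / (2 * t))\<^sup>2 = cubic j1 j2 (w $ 3) / (4 * t\<^sup>2)"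
    using reduced_surfaceD(1)[OF assms(2)]
    by (simp add: power_divide power_mult_distrib add_divide_distrib[symmetric] add.commute)
  also have "\<dots> = - 2 * (j2 + w $ 3)"
    unfolding t(2) using assms(3) by (simp add: cubic_def field_simps)
  finally show "section_p j1 w \<in> level_set j1 j2"
    using t by (simp add: level_set_iff[OF assms(1)] sec)
  show "invariants (section_p j1 w) = w"
    using t(1) by (intro vec3_eqI) (simp_all add: invariants_nth w1_def w2_def sec)
qed

lemma smooth_on_section_x: "smooth_on {w. j2 + w $ 3 < 0} (section_x j2)"
proof -
  have o: "open {w :: real^3. j2 + w $ 3 < 0}"
    by (intro open_Collect_less continuous_intros)
  show ?thesis
    unfolding section_x_def Let_def by (intro smooth_intros o) auto
qed

lemma smooth_on_section_p: "smooth_on {w. (w $ 3)\<^sup>2 < j1\<^sup>2} (section_p j1)"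
proof -
  have o: "open {w :: real^3. (w $ 3)\<^sup>2 < j1\<^sup>2}"
    by (intro open_Collect_less continuous_intros)
  show ?thesis
    unfolding section_p_def Let_def by (intro smooth_intros o) auto
qed

text \<open>A point of the surface lies in the range of one of the two sections, unless both \<open>x\<close> and the
  horizontal momentum have to vanish, and then it is the image of a fixed point.\<close>

lemma invariants_level_set:
  assumes "j1 \<ge> 0"
  shows "invariants ` level_set j1 j2 = reduced_surface j1 j2"
proof
  show "invariants ` level_set j1 j2 \<subseteq> reduced_surface j1 j2"
    using invariants_reduced_surface[OF assms] by blast
  show "reduced_surface j1 j2 \<subseteq> invariants ` level_set j1 j2"
  proof
    fix w assume w: "w \<in> reduced_surface j1 j2"
    note facts = reduced_surfaceD[OF w]
    consider "j2 + w $ 3 < 0" | "(w $ 3)\<^sup>2 < j1\<^sup>2" | "j2 + w $ 3 = 0" "(w $ 3)\<^sup>2 = j1\<^sup>2"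
      using facts(2,3) assms power2_le_iff_abs_le[of j1 "w $ 3"] by linarith
    then show "w \<in> invariants ` level_set j1 j2"
    proof cases
      case 1
      then show ?thesis using section_x[OF assms w] by (metis imageI)
    next
      case 2
      then show ?thesis using section_p[OF assms w] by (metis imageI)
    next
      case 3
      define z :: phase where "z = (0, vector [0, 0, w $ 3])"
      have "z \<in> level_set j1 j2" using 3 by (simp add: z_def level_set_iff[OF assms])
      moreover have "w $ 1 = 0" "w $ 2 = 0"
        using facts(1) 3 by (auto simp: cubic_def sum_power2_eq_zero_iff)
      then have "invariants z = w" by (intro vec3_eqI) (simp_all add: z_def invariants_nth w1_def w2_def)
      ultimately show ?thesis by blast
    qed
  qed
qed

text \<open>An orbit which is not a fixed point has \<open>x \<noteq> 0\<close> or \<open>(\<pi>\<^sub>1, \<pi>\<^sub>2) \<noteq> 0\<close>, so one of the two explicit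
  sections is smooth near its image.\<close>

lemma local_section:
  assumes "j1 \<ge> 0" "z \<in> level_set j1 j2" "\<not> is_singleton (circle_orbit z)"
  obtains W \<sigma> where "open W" "invariants z \<in> W" "smooth_on W \<sigma>"
    "\<And>w. w \<in> reduced_surface j1 j2 \<Longrightarrow> w \<in> W \<Longrightarrow> \<sigma> w \<in> level_set j1 j2 \<and> invariants (\<sigma> w) = w"
proof -
  have q: "(snd z $ 1)\<^sup>2 + (snd z $ 2)\<^sup>2 = j1\<^sup>2 - (snd z $ 3)\<^sup>2"
    and x: "(fst z $ 1)\<^sup>2 + (fst z $ 2)\<^sup>2 = - 2 * (j2 + snd z $ 3)"
    using assms by (auto simp: level_set_iff)
  consider "(fst z $ 1)\<^sup>2 + (fst z $ 2)\<^sup>2 > 0" | "(snd z $ 1)\<^sup>2 + (snd z $ 2)\<^sup>2 > 0"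
    using assms(3) circle_orbit_singleton[of z] by (auto simp: sum_power2_gt_zero_iff vec_eq_iff forall_2)
  then show thesis
  proof cases
    case 1
    show thesis
    proof (rule that[of "{w. j2 + w $ 3 < 0}" "section_x j2"])
      show "open {w :: real^3. j2 + w $ 3 < 0}" by (intro open_Collect_less continuous_intros)
    qed (use 1 x section_x[OF assms(1)] smooth_on_section_x in \<open>auto simp: invariants_nth\<close>)
  next
    case 2
    show thesis
    proof (rule that[of "{w. (w $ 3)\<^sup>2 < j1\<^sup>2}" "section_p j1"])
      show "open {w :: real^3. (w $ 3)\<^sup>2 < j1\<^sup>2}" by (intro open_Collect_less continuous_intros)
    qed (use 2 q section_p[OF assms(1)] smooth_on_section_p in \<open>auto simp: invariants_nth\<close>)
  qed
qed

text \<open>Smooth functions on the surface pull back along the polynomial map \<^const>\<open>invariants\<close>;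
  invariant smooth functions on the level set descend along a local section.\<close>

lemma orbit_diffeo_reduced_coords:
  assumes "j1 \<ge> 0" "m \<in> reduced_space j1 j2" "\<not> is_singleton m"
  shows "orbit_diffeo_at j1 j2 reduced_coords (reduced_surface j1 j2) m"
  unfolding orbit_diffeo_at_def
proof (intro allI iffI)
  fix g :: "real^3 \<Rightarrow> real"
  obtain z where z: "z \<in> level_set j1 j2" "m = circle_orbit z"
    using assms(2) by (auto simp: reduced_space_def)
  have mem: "y \<in> level_set j1 j2 \<and> circle_orbit y = m" if y: "y \<in> m" for y
  proof -
    obtain \<theta> where "y = circle_act \<theta> z" using y z(2) by (auto simp: circle_orbit_def)
    then show ?thesis using circle_act_level_set[OF assms(1) z(1)] z(2) by (simp add: circle_orbit_circle_act)
  qed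
  have pullback: "(g \<circ> reduced_coords) \<circ> circle_orbit = g \<circ> invariants"
    by (simp add: fun_eq_iff reduced_coords_orbit)
  show "orbit_smooth j1 j2 (g \<circ> reduced_coords) m"
    if "smooth_within (reduced_surface j1 j2) g (reduced_coords m)"
    unfolding orbit_smooth_def pullback
  proof
    fix y assume "y \<in> m"
    then have "invariants y = reduced_coords m" using mem reduced_coords_orbit by metis
    then show "smooth_within (level_set j1 j2) (g \<circ> invariants) y"
      using that invariants_reduced_surface[OF assms(1)]
      by (intro smooth_within_compose[OF _ open_UNIV UNIV_I smooth_on_invariants]) auto
  qed
  assume os: "orbit_smooth j1 j2 (g \<circ> reduced_coords) m"
  obtain W \<sigma> where W: "open W" "invariants z \<in> W" "smooth_on W \<sigma>"
    and \<sigma>: "\<And>w. w \<in> reduced_surface j1 j2 \<Longrightarrow> w \<in> W \<Longrightarrow> \<sigma> w \<in> level_set j1 j2 \<and> invariants (\<sigma> w) = w"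
    using local_section[OF assms(1) z(1)] assms(3) z(2) by blast
  have w: "invariants z \<in> reduced_surface j1 j2" using invariants_reduced_surface assms(1) z(1) by blast
  have "circle_orbit (\<sigma> (invariants z)) = m"
    using invariants_separate_orbits[OF assms(1) _ z(1)] \<sigma>[OF w W(2)] z(2) by blast
  then have "\<sigma> (invariants z) \<in> m" using circle_orbit_refl by metis
  then have "smooth_within (level_set j1 j2) (g \<circ> invariants) (\<sigma> (invariants z))"
    using os unfolding orbit_smooth_def pullback by blast
  then have "smooth_within (reduced_surface j1 j2) ((g \<circ> invariants) \<circ> \<sigma>) (invariants z)"
    using \<sigma> by (intro smooth_within_compose[OF _ W]) auto
  then have "smooth_within (reduced_surface j1 j2) g (invariants z)"
    by (rule smooth_within_cong_local[OF _ W(1,2)]) (use \<sigma> in auto)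
  then show "smooth_within (reduced_surface j1 j2) g (reduced_coords m)"
    by (simp add: z(2) reduced_coords_orbit)
qed

lemma compact_level_set:
  assumes "j1 \<ge> 0"
  shows "compact (level_set j1 j2)"
proof -
  have eq: "level_set j1 j2 = {z. (snd z $ 1)\<^sup>2 + (snd z $ 2)\<^sup>2 = j1\<^sup>2 - (snd z $ 3)\<^sup>2} \<inter>
      {z. (fst z $ 1)\<^sup>2 + (fst z $ 2)\<^sup>2 = - 2 * (j2 + snd z $ 3)}"
    using level_set_iff[OF assms] by auto
  have "closed (level_set j1 j2)"
    unfolding eq by (intro closed_Int closed_Collect_eq continuous_intros)
  moreover have "bounded (level_set j1 j2)"
  proof (rule bounded_subset)
    show "bounded (cball 0 (sqrt (2 * (j1 - j2))) \<times> cball (0 :: real^3) j1 :: phase set)"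
      by (intro bounded_Times bounded_cball)
    show "level_set j1 j2 \<subseteq> cball 0 (sqrt (2 * (j1 - j2))) \<times> cball 0 j1"
    proof
      fix z assume "z \<in> level_set j1 j2"
      then have q: "(snd z $ 1)\<^sup>2 + (snd z $ 2)\<^sup>2 = j1\<^sup>2 - (snd z $ 3)\<^sup>2"
        and x: "(fst z $ 1)\<^sup>2 + (fst z $ 2)\<^sup>2 = - 2 * (j2 + snd z $ 3)"
        using assms by (auto simp: level_set_iff)
      have "(snd z $ 3)\<^sup>2 \<le> j1\<^sup>2" using q by (smt (verit) zero_le_power2)
      then have "- j1 \<le> snd z $ 3" using assms power2_le_iff_abs_le[of j1 "snd z $ 3"] by linarith
      then have "norm (fst z) \<le> sqrt (2 * (j1 - j2))"
        using x by (simp add: norm_vec_def L2_set_def sum_2)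
      moreover have "norm (snd z) \<le> j1"
        using q assms by (simp add: norm_vec_def L2_set_def sum_3 algebra_simps)
      ultimately show "z \<in> cball 0 (sqrt (2 * (j1 - j2))) \<times> cball 0 j1"
        by (simp add: mem_Times_iff)
    qed
  qed
  ultimately show ?thesis using compact_eq_bounded_closed by blast
qed

text \<open>A continuous bijection from a compact space to a Hausdorff space.\<close>

lemma reduced_coords_homeomorphic_map:
  assumes "j1 \<ge> 0"
  shows "homeomorphic_map (reduced_topology j1 j2) (top_of_set (reduced_surface j1 j2)) reduced_coords"
proof (rule continuous_imp_homeomorphic_map)
  have "compact_space (top_of_set (level_set j1 j2))"
    using compact_level_set[OF assms] by (simp add: compact_space_subtopology compactin_euclidean_iff)
  then show "compact_space (reduced_topology j1 j2)"
    unfolding compact_space_def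
    using image_compactin quotient_imp_continuous_map quotient_imp_surjective_map quotient_map_circle_orbit by metis
  show "Hausdorff_space (top_of_set (reduced_surface j1 j2))"
    by (simp add: Hausdorff_space_subtopology)
  have "continuous_map (top_of_set (level_set j1 j2)) (top_of_set (reduced_surface j1 j2)) (reduced_coords \<circ> circle_orbit)"
    using invariants_level_set[OF assms, of j2] smooth_on_imp_continuous_on[OF smooth_on_invariants]
    by (auto simp: comp_def reduced_coords_orbit intro: continuous_on_subset)
  then show "continuous_map (reduced_topology j1 j2) (top_of_set (reduced_surface j1 j2)) reduced_coords"
    using continuous_compose_quotient_map_eq quotient_map_circle_orbit by blast
  show "reduced_coords ` topspace (reduced_topology j1 j2) = topspace (top_of_set (reduced_surface j1 j2))"
    by (simp add: topspace_reduced_topology reduced_space_def image_image reduced_coords_orbit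
        invariants_level_set[OF assms])
  show "inj_on reduced_coords (topspace (reduced_topology j1 j2))"
  proof (rule inj_onI)
    fix m m' assume "m \<in> topspace (reduced_topology j1 j2)" "m' \<in> topspace (reduced_topology j1 j2)"
      and eq: "reduced_coords m = reduced_coords m'"
    then obtain z z' where z: "z \<in> level_set j1 j2" "z' \<in> level_set j1 j2" "m = circle_orbit z" "m' = circle_orbit z'"
      by (auto simp: topspace_reduced_topology reduced_space_def)
    then show "m = m'"
      using invariants_separate_orbits[OF assms z(1,2)] eq by (simp add: reduced_coords_orbit)
  qed
qed

section \<open>Surfaces of revolution of cubics and the unit sphere\<close>

text \<open>Naming the three roots in increasing order \<open>a < b \<le> c\<close> treats the cases \<open>j\<^sub>2 < - j\<^sub>1\<close>,
  \<open>j\<^sub>2 = - j\<^sub>1\<close> and \<open>j\<^sub>2 > - j\<^sub>1\<close> together; the surface is singular precisely when \<open>b = c\<close>.\<close>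

definition cubic_surface :: "real \<Rightarrow> real \<Rightarrow> real \<Rightarrow> (real^3) set" where
  "cubic_surface a b c =
     {w. (w$1)\<^sup>2 + (w$2)\<^sup>2 = 8 * (w$3 - a) * (b - w$3) * (c - w$3) \<and> a \<le> w$3 \<and> w$3 \<le> b}"

lemma cubic_factor:
  "cubic j1 j2 s = 8 * (s - (- j1)) * (min j1 (- j2) - s) * (max j1 (- j2) - s)"
  by (cases "j1 \<le> - j2") (simp_all add: cubic_def power2_eq_square algebra_simps)

lemma reduced_surface_eq_cubic_surface:
  "reduced_surface j1 j2 = cubic_surface (- j1) (min j1 (- j2)) (max j1 (- j2))"
  unfolding reduced_surface_def cubic_surface_def cubic_factor by (rule refl)

text \<open>The affine change of height that sends \<open>[a, b]\<close> to \<open>[- 1, 1]\<close> turns \<open>4 (s - a) (b - s)\<close> into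
  \<open>(b - a)\<^sup>2\<close> times \<open>1 - u\<^sup>2\<close>. The remaining factor \<open>2 (c - s)\<close> of the cubic
  is positive below height \<open>c\<close>, and its square root rescales the radius.\<close>

definition radius_factor :: "real \<Rightarrow> real \<Rightarrow> real \<Rightarrow> real \<Rightarrow> real" where
  "radius_factor a b c s = (b - a) * sqrt (2 * (c - s))"

definition to_sphere :: "real \<Rightarrow> real \<Rightarrow> real \<Rightarrow> real^3 \<Rightarrow> real^3" where
  "to_sphere a b c w = vector [w$1 / radius_factor a b c (w$3), w$2 / radius_factor a b c (w$3),
     (2 * w$3 - a - b) / (b - a)]"

definition from_sphere :: "real \<Rightarrow> real \<Rightarrow> real \<Rightarrow> real^3 \<Rightarrow> real^3" where
  "from_sphere a b c v = (let s = (a + b + (b - a) * v$3) / 2 in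
     vector [v$1 * radius_factor a b c s, v$2 * radius_factor a b c s, s])"

lemma to_sphere_nth:
  "to_sphere a b c w $ 1 = w$1 / radius_factor a b c (w$3)"
  "to_sphere a b c w $ 2 = w$2 / radius_factor a b c (w$3)"
  "to_sphere a b c w $ 3 = (2 * w$3 - a - b) / (b - a)"
  by (simp_all add: to_sphere_def)

lemma from_sphere_nth:
  "from_sphere a b c v $ 1 = v$1 * radius_factor a b c (from_sphere a b c v $ 3)"
  "from_sphere a b c v $ 2 = v$2 * radius_factor a b c (from_sphere a b c v $ 3)"
  "from_sphere a b c v $ 3 = (a + b + (b - a) * v$3) / 2"
  by (simp_all add: from_sphere_def Let_def)

lemma unit_sphere_iff: "v \<in> unit_sphere \<longleftrightarrow> (v$1)\<^sup>2 + (v$2)\<^sup>2 = 1 - (v$3)\<^sup>2"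
  by (auto simp: norm_vec_def L2_set_def sum_3)

lemma radius_factor_pos: "a < b \<Longrightarrow> s < c \<Longrightarrow> radius_factor a b c s > 0"
  by (simp add: radius_factor_def)

lemma to_from_sphere:
  assumes "a < b" "from_sphere a b c v $ 3 < c"
  shows "to_sphere a b c (from_sphere a b c v) = v"
  using radius_factor_pos[OF assms] assms(1)
  by (intro vec3_eqI) (simp_all add: to_sphere_nth from_sphere_nth(1,2), simp add: from_sphere_nth(3) field_simps)

lemma from_to_sphere:
  assumes "a < b" "w $ 3 < c"
  shows "from_sphere a b c (to_sphere a b c w) = w"
proof -
  have "from_sphere a b c (to_sphere a b c w) $ 3 = w $ 3"
    using assms(1) by (simp add: from_sphere_nth(3) to_sphere_nth(3))
  then show ?thesis
    using radius_factor_pos[OF assms]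
    by (intro vec3_eqI) (simp_all add: from_sphere_nth(1,2) to_sphere_nth(1,2))
qed

lemma from_sphere_in_cubic_surface:
  assumes "a < b" "b \<le> c" "v \<in> unit_sphere"
  shows "from_sphere a b c v \<in> cubic_surface a b c"
proof -
  define s where "s = from_sphere a b c v $ 3"
  have v: "(v$1)\<^sup>2 + (v$2)\<^sup>2 = 1 - (v$3)\<^sup>2" using assms(3) unit_sphere_iff by blast
  then have "(v$3)\<^sup>2 \<le> 1" by (smt (verit) zero_le_power2)
  then have v3: "- 1 \<le> v$3" "v$3 \<le> 1" using abs_square_le_1 by (auto simp: abs_le_iff)
  have "(b - a) * v$3 \<le> (b - a) * 1" "(b - a) * (-1) \<le> (b - a) * v$3"
    using v3 assms(1) by (intro mult_left_mono; simp)+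
  then have s: "a \<le> s" "s \<le> b" by (simp_all add: s_def from_sphere_nth(3))
  have "(from_sphere a b c v $ 1)\<^sup>2 + (from_sphere a b c v $ 2)\<^sup>2 = ((v$1)\<^sup>2 + (v$2)\<^sup>2) * (radius_factor a b c s)\<^sup>2"
    by (simp add: from_sphere_nth(1,2) s_def power_mult_distrib algebra_simps)
  also have "(radius_factor a b c s)\<^sup>2 = (b - a)\<^sup>2 * (2 * (c - s))"
    using s(2) assms(2) by (simp add: radius_factor_def power_mult_distrib)
  also have "((v$1)\<^sup>2 + (v$2)\<^sup>2) * ((b - a)\<^sup>2 * (2 * (c - s))) = 8 * (s - a) * (b - s) * (c - s)"
    unfolding v s_def from_sphere_nth(3) by (simp add: power2_eq_square field_simps)
  finally show ?thesis using s by (simp add: cubic_surface_def s_def[symmetric])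
qed

lemma to_sphere_in_unit_sphere:
  assumes "a < b" "w \<in> cubic_surface a b c" "w $ 3 < c"
  shows "to_sphere a b c w \<in> unit_sphere"
proof -
  have "(to_sphere a b c w $ 1)\<^sup>2 + (to_sphere a b c w $ 2)\<^sup>2 = ((w$1)\<^sup>2 + (w$2)\<^sup>2) / (radius_factor a b c (w$3))\<^sup>2"
    by (simp add: to_sphere_nth power_divide add_divide_distrib)
  also have "(radius_factor a b c (w$3))\<^sup>2 = (b - a)\<^sup>2 * (2 * (c - w$3))"
    using assms(3) by (simp add: radius_factor_def power_mult_distrib)
  also have "(w$1)\<^sup>2 + (w$2)\<^sup>2 = (4 * (w$3 - a) * (b - w$3)) * (2 * (c - w$3))"
    using assms(2) by (simp add: cubic_surface_def algebra_simps)
  also have "(4 * (w$3 - a) * (b - w$3)) * (2 * (c - w$3)) / ((b - a)\<^sup>2 * (2 * (c - w$3))) = (4 * (w$3 - a) * (b - w$3)) / (b - a)\<^sup>2"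
    using assms(3) by simp
  also have "\<dots> = ((b - a)\<^sup>2 - (2 * w$3 - a - b)\<^sup>2) / (b - a)\<^sup>2"
    by (simp add: power2_eq_square algebra_simps)
  also have "\<dots> = 1 - (to_sphere a b c w $ 3)\<^sup>2"
    using assms(1) unfolding to_sphere_nth power_divide by (simp add: diff_divide_distrib)
  finally show ?thesis by (simp only: unit_sphere_iff)
qed

lemma open_below: "open {w :: real^3. w $ 3 < c}"
  by (intro open_Collect_less continuous_intros)

lemma open_from_sphere_below: "open {v. from_sphere a b c v $ 3 < c}"
  unfolding from_sphere_nth by (intro open_Collect_less continuous_intros) simp

lemma smooth_on_to_sphere:
  assumes "a < b"
  shows "smooth_on {w. w $ 3 < c} (to_sphere a b c)"
  unfolding to_sphere_def
  using radius_factor_pos[OF assms] assms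
  by (intro smooth_intros open_below; simp add: radius_factor_def; intro smooth_intros open_below; simp)

lemma smooth_on_from_sphere:
  "smooth_on {v. from_sphere a b c v $ 3 < c} (from_sphere a b c)"
  unfolding from_sphere_def Let_def radius_factor_def
  by (intro smooth_intros open_from_sphere_below[unfolded from_sphere_def Let_def radius_factor_def]) simp_all

lemma homeomorphism_below_to_sphere:
  assumes "a < b"
  shows "homeomorphism {w. w $ 3 < c} {v. from_sphere a b c v $ 3 < c} (to_sphere a b c) (from_sphere a b c)"
  by (rule homeomorphismI)
    (use to_from_sphere[OF assms] from_to_sphere[OF assms] smooth_on_to_sphere[OF assms] smooth_on_from_sphere
      in \<open>auto intro: smooth_on_imp_continuous_on\<close>)

lemma smooth_diffeo_to_sphere:
  assumes "a < b"
  shows "smooth_diffeo {w. w $ 3 < c} {v. from_sphere a b c v $ 3 < c} (to_sphere a b c)"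
  unfolding smooth_diffeo_def
proof (intro conjI exI)
  show "homeomorphism {w. w $ 3 < c} {v. from_sphere a b c v $ 3 < c} (to_sphere a b c) (from_sphere a b c)"
    by (rule homeomorphism_below_to_sphere[OF assms])
qed (use open_below open_from_sphere_below smooth_on_to_sphere[OF assms] smooth_on_from_sphere in auto)

text \<open>If \<open>b < c\<close> this covers the whole surface, and if \<open>b = c\<close> all of it except the top point.\<close>

lemma cubic_surface_submanifold_at:
  assumes "a < b" "b \<le> c" "w \<in> cubic_surface a b c" "w $ 3 < c"
  shows "submanifold_at 2 (cubic_surface a b c) w"
proof (rule submanifold_at_diffeo[OF smooth_diffeo_to_sphere[OF assms(1)]])
  show "w \<in> {w. w $ 3 < c}" using assms(4) by simp
  show "to_sphere a b c ` (cubic_surface a b c \<inter> {w. w $ 3 < c}) = unit_sphere \<inter> {v. from_sphere a b c v $ 3 < c}"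
  proof (intro equalityI subsetI)
    fix v assume "v \<in> unit_sphere \<inter> {v. from_sphere a b c v $ 3 < c}"
    then show "v \<in> to_sphere a b c ` (cubic_surface a b c \<inter> {w. w $ 3 < c})"
      using from_sphere_in_cubic_surface[OF assms(1,2)] to_from_sphere[OF assms(1)]
      by (intro image_eqI[of _ _ "from_sphere a b c v"]) auto
  qed (use to_sphere_in_unit_sphere[OF assms(1)] from_to_sphere[OF assms(1)] in auto)
  show "submanifold_at 2 unit_sphere (to_sphere a b c w)"
    using sphere_submanifold_at[of "to_sphere a b c w"] to_sphere_in_unit_sphere[OF assms(1,3,4)] by simp
qed

lemma homeomorphism_to_sphere:
  assumes "a < b" "b < c"
  shows "homeomorphism (cubic_surface a b c) unit_sphere (to_sphere a b c) (from_sphere a b c)"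
proof (rule homeomorphism_of_subsets[of "{w. w $ 3 < c}" "{v. from_sphere a b c v $ 3 < c}"])
  show "homeomorphism {w. w $ 3 < c} {v. from_sphere a b c v $ 3 < c} (to_sphere a b c) (from_sphere a b c)"
    by (rule homeomorphism_below_to_sphere[OF assms(1)])
  show below: "cubic_surface a b c \<subseteq> {w. w $ 3 < c}" using assms(2) by (auto simp: cubic_surface_def)
  show V: "unit_sphere \<subseteq> {v. from_sphere a b c v $ 3 < c}"
    using below from_sphere_in_cubic_surface[OF assms(1) less_imp_le[OF assms(2)]] by blast
  show "to_sphere a b c ` cubic_surface a b c = unit_sphere"
  proof (intro equalityI subsetI)
    fix v assume "v \<in> unit_sphere"
    then show "v \<in> to_sphere a b c ` cubic_surface a b c"
      using V from_sphere_in_cubic_surface[OF assms(1), of c v] to_from_sphere[OF assms(1), of c v] assms(2)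
      by (intro image_eqI[of _ _ "from_sphere a b c v"]) auto
  qed (use to_sphere_in_unit_sphere[OF assms(1)] below in auto)
qed

text \<open>For \<open>b = c\<close> the rescaling of the radius degenerates at the north pole, but only that one point is
  sent to height \<open>c\<close>, so \<^const>\<open>from_sphere\<close> stays a continuous bijection.\<close>

lemma homeomorphic_sphere_cubic_surface:
  assumes "a < b" "b \<le> c"
  shows "unit_sphere homeomorphic cubic_surface a b c"
proof (rule homeomorphic_compact)
  show "continuous_on unit_sphere (from_sphere a b c)"
  proof (rule continuous_on_subset[OF _ subset_UNIV])
    have "continuous_on UNIV (\<lambda>v. from_sphere a b c v $ i)" for i
      using exhaust_3[of i] unfolding from_sphere_nth(1,2) radius_factor_def from_sphere_nth(3)
      by (elim disjE; hypsubst; unfold from_sphere_nth(1,2) radius_factor_def from_sphere_nth(3);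
          intro continuous_intros) auto
    then show "continuous_on UNIV (from_sphere a b c)"
      using continuous_on_vec_lambda[of UNIV "\<lambda>i v. from_sphere a b c v $ i"] by simp
  qed
  show "from_sphere a b c ` unit_sphere = cubic_surface a b c"
  proof (intro equalityI subsetI)
    fix w assume w: "w \<in> cubic_surface a b c"
    show "w \<in> from_sphere a b c ` unit_sphere"
    proof (cases "w $ 3 < c")
      case True
      then show ?thesis
        using to_sphere_in_unit_sphere[OF assms(1) w] from_to_sphere[OF assms(1)] by (metis imageI)
    next
      case False
      then have "w $ 3 = b"
        using w assms(2) by (simp add: cubic_surface_def)
      moreover from this have "w $ 1 = 0" "w $ 2 = 0"
        using w by (auto simp: cubic_surface_def sum_power2_eq_zero_iff)
      ultimately have "from_sphere a b c (vector [0, 0, 1]) = w"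
        by (intro vec3_eqI) (simp_all add: from_sphere_nth)
      moreover have "vector [0, 0, 1] \<in> unit_sphere" by (simp only: unit_sphere_iff) simp
      ultimately show ?thesis by blast
    qed
  qed (use from_sphere_in_cubic_surface[OF assms] in blast)
  show "inj_on (from_sphere a b c) unit_sphere"
  proof (rule inj_onI)
    fix u v assume u: "u \<in> unit_sphere" and v: "v \<in> unit_sphere" and eq: "from_sphere a b c u = from_sphere a b c v"
    have eq3: "u $ 3 = v $ 3"
      using arg_cong[OF eq, of "\<lambda>w. w $ 3"] assms(1) by (simp add: from_sphere_nth(3))
    show "u = v"
    proof (cases "from_sphere a b c v $ 3 < c")
      case True
      then show ?thesis using to_from_sphere[OF assms(1)] eq by metis
    next
      case False
      \<comment> \<open>only the north pole is sent to height \<open>c\<close>\<close>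
      have "from_sphere a b c v $ 3 \<le> b"
        using from_sphere_in_cubic_surface[OF assms v] by (simp add: cubic_surface_def)
      then have "from_sphere a b c v $ 3 = b" using False assms(2) by linarith
      then have "(b - a) * v $ 3 = (b - a) * 1" unfolding from_sphere_nth(3) by (simp add: field_simps)
      then have "v $ 3 = 1" using assms(1) by simp
      then show ?thesis
        using u v eq3 unfolding unit_sphere_iff by (intro vec3_eqI) (auto simp: sum_power2_eq_zero_iff)
    qed
  qed
qed simp

section \<open>The conical singularity\<close>

definition apex_cone :: "real \<Rightarrow> (real^3) set" where
  "apex_cone j = {w. sqrt ((w$1)\<^sup>2 + (w$2)\<^sup>2) = 4 * sqrt j * (j - w$3)}"

lemma apex_cone_iff:
  assumes "j > 0"
  shows "w \<in> apex_cone j \<longleftrightarrow> (w$1)\<^sup>2 + (w$2)\<^sup>2 = 16 * j * (w$3 - j)\<^sup>2 \<and> w$3 \<le> j"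
proof -
  have sq: "(4 * sqrt j * (j - w$3))\<^sup>2 = 16 * j * (w$3 - j)\<^sup>2"
    using assms by (simp add: power_mult_distrib power2_commute)
  have "sqrt q = t \<longleftrightarrow> q = t\<^sup>2 \<and> 0 \<le> t" if "q \<ge> 0" for q t :: real
    using that by (metis real_sqrt_ge_zero real_sqrt_pow2 real_sqrt_unique)
  then have "w \<in> apex_cone j \<longleftrightarrow> (w$1)\<^sup>2 + (w$2)\<^sup>2 = (4 * sqrt j * (j - w$3))\<^sup>2 \<and> 0 \<le> 4 * sqrt j * (j - w$3)"
    by (simp add: apex_cone_def)
  then show ?thesis
    unfolding sq using assms by (simp add: zero_le_mult_iff)
qed

text \<open>For \<open>b = c = j\<close> the surface is given by \<open>w\<^sub>1\<^sup>2 + w\<^sub>2\<^sup>2 = 8 (s + j) (s - j)\<^sup>2\<close> with \<open>s\<close> the height. Multiplying the radius by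
  this factor replaces \<open>s + j\<close> by its value \<open>2 j\<close> at the apex, which leaves the equation of
  a round cone.\<close>

definition cone_factor :: "real \<Rightarrow> real \<Rightarrow> real" where
  "cone_factor j s = sqrt (2 * j / (s + j))"

definition straighten :: "real \<Rightarrow> real^3 \<Rightarrow> real^3" where
  "straighten j w = vector [w$1 * cone_factor j (w$3), w$2 * cone_factor j (w$3), w$3]"

definition unstraighten :: "real \<Rightarrow> real^3 \<Rightarrow> real^3" where
  "unstraighten j w = vector [w$1 / cone_factor j (w$3), w$2 / cone_factor j (w$3), w$3]"

lemma straighten_nth:
  "straighten j w $ 1 = w$1 * cone_factor j (w$3)" "straighten j w $ 2 = w$2 * cone_factor j (w$3)" "straighten j w $ 3 = w$3"
  "unstraighten j w $ 1 = w$1 / cone_factor j (w$3)" "unstraighten j w $ 2 = w$2 / cone_factor j (w$3)" "unstraighten j w $ 3 = w$3"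
  by (simp_all add: straighten_def unstraighten_def)

lemma cone_factor_pos: "j > 0 \<Longrightarrow> - j < s \<Longrightarrow> cone_factor j s > 0"
  by (simp add: cone_factor_def)

lemma straighten_inverse:
  assumes "j > 0" "- j < w $ 3"
  shows "unstraighten j (straighten j w) = w" "straighten j (unstraighten j w) = w"
  using cone_factor_pos[OF assms] by (intro vec3_eqI; simp add: straighten_nth)+

lemma open_above: "open {w :: real^3. j < w $ 3}"
  by (intro open_Collect_less continuous_intros)

lemma smooth_diffeo_straighten:
  assumes "j > 0"
  shows "smooth_diffeo {w. - j < w $ 3} {w. - j < w $ 3} (straighten j)"
proof -
  have k: "smooth_on {w :: real^3. - j < w $ 3} (\<lambda>w. cone_factor j (w $ 3))"
    unfolding cone_factor_def using assms by (intro smooth_intros open_above) auto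
  have s: "smooth_on {w. - j < w $ 3} (straighten j)" "smooth_on {w. - j < w $ 3} (unstraighten j)"
    unfolding straighten_def unstraighten_def using cone_factor_pos[OF assms]
    by (intro smooth_intros open_above k; simp)+
  have "homeomorphism {w. - j < w $ 3} {w. - j < w $ 3} (straighten j) (unstraighten j)"
    by (rule homeomorphismI)
       (use s straighten_inverse[OF assms] in \<open>auto simp: straighten_nth intro: smooth_on_imp_continuous_on\<close>)
  then show ?thesis
    unfolding smooth_diffeo_def using s open_above by blast
qed

lemma straighten_cone_iff:
  assumes "j > 0" "- j < w $ 3"
  shows "straighten j w \<in> apex_cone j \<longleftrightarrow> w \<in> cubic_surface (- j) j j"
proof -
  have k: "(cone_factor j (w$3))\<^sup>2 = 2 * j / (w$3 + j)"
    using assms by (simp add: cone_factor_def)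
  have "(straighten j w $ 1)\<^sup>2 + (straighten j w $ 2)\<^sup>2 = ((w$1)\<^sup>2 + (w$2)\<^sup>2) * (2 * j / (w$3 + j))"
    unfolding k[symmetric] by (simp add: straighten_nth power_mult_distrib algebra_simps)
  moreover have "((w$1)\<^sup>2 + (w$2)\<^sup>2) * (2 * j / (w$3 + j)) = 16 * j * (w$3 - j)\<^sup>2 \<longleftrightarrow>
      (w$1)\<^sup>2 + (w$2)\<^sup>2 = 8 * (w$3 - - j) * (j - w$3) * (j - w$3)"
  proof -
    have "((w$1)\<^sup>2 + (w$2)\<^sup>2) * (2 * j / (w$3 + j)) = 16 * j * (w$3 - j)\<^sup>2 \<longleftrightarrow>
        (2 * j) * ((w$1)\<^sup>2 + (w$2)\<^sup>2) = (2 * j) * (8 * (w$3 + j) * (w$3 - j)\<^sup>2)"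
      using assms by (simp add: field_simps)
    also have "\<dots> \<longleftrightarrow> (w$1)\<^sup>2 + (w$2)\<^sup>2 = 8 * (w$3 + j) * (w$3 - j)\<^sup>2"
      using assms(1) by simp
    also have "8 * (w$3 + j) * (w$3 - j)\<^sup>2 = 8 * (w$3 - - j) * (j - w$3) * (j - w$3)"
      by (simp add: power2_eq_square algebra_simps)
    finally show ?thesis .
  qed
  ultimately show ?thesis
    using assms(2) by (simp only: apex_cone_iff[OF assms(1)] cubic_surface_def mem_Collect_eq straighten_nth(3)) auto
qed

lemma apex_plus: "(vector [0, 0, j] + v :: real^3) \<in> apex_cone j \<longleftrightarrow> (v$1)\<^sup>2 + (v$2)\<^sup>2 = 16 * j * (v$3)\<^sup>2 \<and> v$3 \<le> 0"
  if "j > 0" for v :: "real^3"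
  using that by (simp add: apex_cone_iff)

text \<open>After multiplication by \<open>t\<^sub>n\<^sup>2\<close> the equation of the surface passes to the limit and yields the equation of the cone.
  Conversely, the segment from the apex to a point of the cone becomes a curve in the
  surface under the inverse straightening, which is the identity to first order at the apex.\<close>

lemma tangent_cone_apex:
  assumes j: "j > 0"
  shows "tangent_cone (cubic_surface (- j) j j) (vector [0, 0, j]) = {v. vector [0, 0, j] + v \<in> apex_cone j}"
proof (intro equalityI subsetI)
  let ?p = "vector [0, 0, j] :: real^3"
  fix v assume "v \<in> tangent_cone (cubic_surface (- j) j j) ?p"
  then obtain s t where st: "\<And>n. s n \<in> cubic_surface (- j) j j" "\<And>n::nat. 0 < (t n :: real)"
    and s: "s \<longlonglongrightarrow> ?p" and v: "(\<lambda>n. t n *\<^sub>R (s n - ?p)) \<longlonglongrightarrow> v"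
    unfolding tangent_cone_def by blast
  define x where "x n = t n *\<^sub>R (s n - ?p)" for n
  have x: "(\<lambda>n. x n $ i) \<longlonglongrightarrow> v $ i" for i
    using tendsto_vec_nth[OF v] by (simp add: x_def)
  have "(x n $ 1)\<^sup>2 + (x n $ 2)\<^sup>2 = 8 * (s n $ 3 + j) * (x n $ 3)\<^sup>2" for n
  proof -
    have "(x n $ 1)\<^sup>2 + (x n $ 2)\<^sup>2 = (t n)\<^sup>2 * ((s n $ 1)\<^sup>2 + (s n $ 2)\<^sup>2)"
      by (simp add: x_def power_mult_distrib algebra_simps)
    also have "(s n $ 1)\<^sup>2 + (s n $ 2)\<^sup>2 = 8 * (s n $ 3 + j) * (s n $ 3 - j)\<^sup>2"
      using st(1)[of n] by (simp add: cubic_surface_def power2_eq_square algebra_simps)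
    finally show ?thesis by (simp add: x_def power_mult_distrib)
  qed
  moreover have "(\<lambda>n. (x n $ 1)\<^sup>2 + (x n $ 2)\<^sup>2) \<longlonglongrightarrow> (v $ 1)\<^sup>2 + (v $ 2)\<^sup>2"
    by (intro tendsto_intros x)
  moreover have "(\<lambda>n. 8 * (s n $ 3 + j) * (x n $ 3)\<^sup>2) \<longlonglongrightarrow> 8 * (?p $ 3 + j) * (v $ 3)\<^sup>2"
    by (intro tendsto_intros x s)
  ultimately have "(v $ 1)\<^sup>2 + (v $ 2)\<^sup>2 = 16 * j * (v $ 3)\<^sup>2"
    using LIMSEQ_unique by fastforce
  moreover have "x n $ 3 \<le> 0" for n
    using st(1)[of n] st(2)[of n] by (simp add: x_def cubic_surface_def mult_le_0_iff)
  then have "v $ 3 \<le> 0" using LIMSEQ_le_const2[OF x] by blast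
  ultimately show "v \<in> {v. ?p + v \<in> apex_cone j}" using apex_plus[OF j] by simp
next
  let ?p = "vector [0, 0, j] :: real^3"
  fix v assume "v \<in> {v. ?p + v \<in> apex_cone j}"
  then have v: "(v$1)\<^sup>2 + (v$2)\<^sup>2 = 16 * j * (v$3)\<^sup>2" "v$3 \<le> 0" using apex_plus[OF j] by auto
  \<comment> \<open>small enough to keep \<open>vector [0, 0, j] + h n *\<^sub>R v\<close> above height \<open>- j\<close>, where the straightening is invertible\<close>
  define h where "h n = j / (1 - v$3) * inverse (real (Suc n))" for n
  define y where "y n = ?p + h n *\<^sub>R v" for n
  define s where "s n = unstraighten j (y n)" for n
  have h: "h n > 0" for n using j v(2) by (simp add: h_def)
  have h0: "h \<longlonglongrightarrow> 0"
    using tendsto_mult_left[OF LIMSEQ_inverse_real_of_nat, of "j / (1 - v$3)"] by (simp add: h_def[abs_def])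
  have below: "- j < y n $ 3" for n
  proof -
    have "h n \<le> j / (1 - v$3) * 1"
      unfolding h_def using j v(2) by (intro mult_left_mono) (auto simp: field_simps)
    then have "h n * (- v$3) \<le> j / (1 - v$3) * (- v$3)"
      using v(2) by (intro mult_right_mono) auto
    also have "\<dots> \<le> j" using j v(2) by (simp add: field_simps)
    finally show ?thesis using j by (simp add: y_def)
  qed
  have "y n \<in> apex_cone j" for n
    unfolding y_def apex_plus[OF j] using v h[of n]
    by (simp add: power_mult_distrib mult_le_0_iff) (metis (no_types, lifting) distrib_left mult.left_commute)
  then have in_S: "s n \<in> cubic_surface (- j) j j" for n
    using straighten_cone_iff[OF j, of "s n"] straighten_inverse(2)[OF j below[of n]] below[of n]
    by (simp add: s_def straighten_nth)
  have y: "y \<longlonglongrightarrow> ?p"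
    using tendsto_add[OF tendsto_const tendsto_scaleR[OF h0 tendsto_const], of ?p v] by (simp add: y_def[abs_def])
  have "(\<lambda>n. cone_factor j (y n $ 3)) \<longlonglongrightarrow> cone_factor j (?p $ 3)"
    unfolding cone_factor_def using j by (intro tendsto_intros y) auto
  then have k: "(\<lambda>n. cone_factor j (y n $ 3)) \<longlonglongrightarrow> 1"
    using j by (simp add: cone_factor_def)
  have scaled: "(\<lambda>n. inverse (h n) *\<^sub>R (s n - ?p)) \<longlonglongrightarrow> v"
  proof (rule vec_tendstoI)
    fix i
    have eq: "(inverse (h n) *\<^sub>R (s n - ?p)) $ i = (if i = 3 then v $ i else v $ i / cone_factor j (y n $ 3))" for n
      using exhaust_3[of i] h[of n] by (auto simp: s_def straighten_nth y_def)
    have "(\<lambda>n. v $ i / cone_factor j (y n $ 3)) \<longlonglongrightarrow> v $ i / 1"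
      by (intro tendsto_intros k) simp
    then show "(\<lambda>n. (inverse (h n) *\<^sub>R (s n - ?p)) $ i) \<longlonglongrightarrow> v $ i"
      unfolding eq by (cases "i = 3") simp_all
  qed
  have "(\<lambda>n. ?p + h n *\<^sub>R (inverse (h n) *\<^sub>R (s n - ?p))) \<longlonglongrightarrow> ?p + 0 *\<^sub>R v"
    by (intro tendsto_intros h0 scaled)
  then have "s \<longlonglongrightarrow> ?p" using h by (simp add: less_imp_neq[symmetric])
  then show "v \<in> tangent_cone (cubic_surface (- j) j j) ?p"
    unfolding tangent_cone_def using in_S h scaled
    by (intro CollectI exI[of _ s] exI[of _ "\<lambda>n. inverse (h n)"]) auto
qed

lemma translated_tangent_cone_apex:
  "j > 0 \<Longrightarrow> (+) (vector [0, 0, j]) ` tangent_cone (cubic_surface (- j) j j) (vector [0, 0, j]) = apex_cone j"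
  unfolding tangent_cone_apex
  by (force simp: image_iff intro: exI[of _ "x - vector [0, 0, j]" for x])

text \<open>The tangent cone at the apex lies in a half space and meets its boundary only at the origin, so
  it contains no line.\<close>

lemma singular_points_pinched:
  assumes j: "j > 0"
  shows "singular_points 2 (cubic_surface (- j) j j) = {vector [0, 0, j]}"
proof -
  let ?p = "vector [0, 0, j] :: real^3"
  have p: "?p \<in> cubic_surface (- j) j j" using j by (simp add: cubic_surface_def)
  have "\<not> submanifold_at 2 (cubic_surface (- j) j j) ?p"
  proof
    assume "submanifold_at 2 (cubic_surface (- j) j j) ?p"
    then obtain v where v: "v \<noteq> 0" "?p + v \<in> apex_cone j" "?p + - v \<in> apex_cone j"
      using submanifold_at_tangent_line[OF _ p] tangent_cone_apex[OF j] by (metis mem_Collect_eq zero_less_numeral)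
    then have "v $ 3 = 0" "(v$1)\<^sup>2 + (v$2)\<^sup>2 = 16 * j * (v$3)\<^sup>2"
      unfolding apex_plus[OF j] by auto
    then have "v = 0" by (intro vec3_eqI) (auto simp: sum_power2_eq_zero_iff)
    with v(1) show False ..
  qed
  moreover have "submanifold_at 2 (cubic_surface (- j) j j) w"
    if w: "w \<in> cubic_surface (- j) j j" "w \<noteq> ?p" for w
  proof (rule cubic_surface_submanifold_at)
    have "w $ 3 \<noteq> j"
    proof
      assume "w $ 3 = j"
      then have "w = ?p" using w(1) by (intro vec3_eqI) (auto simp: cubic_surface_def sum_power2_eq_zero_iff)
      with w(2) show False ..
    qed
    then show "w $ 3 < j" using w(1) by (simp add: cubic_surface_def)
  qed (use j w in auto)
  ultimately show ?thesis using p unfolding singular_points_def by blast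
qed

lemma conical_singularity_pinched:
  assumes j: "j > 0"
  shows "conical_singularity 2 (cubic_surface (- j) j j) (vector [0, 0, j])"
  unfolding conical_singularity_def
proof (intro conjI exI)
  show "vector [0, 0, j] \<in> singular_points 2 (cubic_surface (- j) j j)"
    using singular_points_pinched[OF j] by simp
  show "smooth_diffeo {w. - j < w $ 3} {w. - j < w $ 3} (straighten j)"
    by (rule smooth_diffeo_straighten[OF j])
  show "vector [0, 0, j] \<in> {w :: real^3. - j < w $ 3}" using j by simp
  show "straighten j (vector [0, 0, j]) = vector [0, 0, j]"
    by (intro vec3_eqI) (simp_all add: straighten_nth)
  show "straighten j ` (cubic_surface (- j) j j \<inter> {w. - j < w $ 3}) =
      (+) (vector [0, 0, j]) ` tangent_cone (cubic_surface (- j) j j) (vector [0, 0, j]) \<inter> {w. - j < w $ 3}"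
    unfolding translated_tangent_cone_apex[OF j]
  proof (intro equalityI subsetI)
    fix w assume w: "w \<in> apex_cone j \<inter> {w. - j < w $ 3}"
    then have "straighten j (unstraighten j w) = w" using straighten_inverse(2)[OF j] by simp
    then show "w \<in> straighten j ` (cubic_surface (- j) j j \<inter> {w. - j < w $ 3})"
      using w straighten_cone_iff[OF j, of "unstraighten j w"]
      by (intro image_eqI[of _ _ "unstraighten j w"]) (auto simp: straighten_nth)
  qed (use straighten_cone_iff[OF j] in \<open>auto simp: straighten_nth\<close>)
qed


section \<open>Geometry of the reduced spaces\<close>

lemma reduced_surface_revolution:
  assumes "j2 \<le> j1"
  shows "reduced_surface j1 j2 = surface_of_revolution (\<lambda>s. sqrt (cubic j1 j2 s)) {- j1..min j1 (- j2)}"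
proof (intro equalityI subsetI)
  fix w assume w: "w \<in> reduced_surface j1 j2"
  define r where "r = sqrt (cubic j1 j2 (w$3))"
  have "cubic j1 j2 (w$3) \<ge> 0" using reduced_surfaceD(1)[OF w] by (metis sum_power2_ge_zero)
  then have "r\<^sup>2 + 0\<^sup>2 = (w$1)\<^sup>2 + (w$2)\<^sup>2" using reduced_surfaceD(1)[OF w] by (simp add: r_def)
  then obtain \<theta> where "cos \<theta> * r - sin \<theta> * 0 = w$1" "sin \<theta> * r + cos \<theta> * 0 = w$2"
    by (rule rotation_exists)
  then have "w = vector [r * cos \<theta>, r * sin \<theta>, w$3]" by (intro vec3_eqI) (simp_all add: mult.commute)
  moreover have "w$3 \<in> {- j1..min j1 (- j2)}" using w by (auto simp: reduced_surface_def)
  ultimately show "w \<in> surface_of_revolution (\<lambda>s. sqrt (cubic j1 j2 s)) {- j1..min j1 (- j2)}"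
    unfolding surface_of_revolution_def r_def by blast
next
  fix w assume "w \<in> surface_of_revolution (\<lambda>s. sqrt (cubic j1 j2 s)) {- j1..min j1 (- j2)}"
  then obtain s \<theta> where s: "s \<in> {- j1..min j1 (- j2)}"
    and w: "w = vector [sqrt (cubic j1 j2 s) * cos \<theta>, sqrt (cubic j1 j2 s) * sin \<theta>, s]"
    unfolding surface_of_revolution_def by blast
  have "cubic j1 j2 s \<ge> 0" unfolding cubic_factor using s by (intro mult_nonneg_nonneg) auto
  then have "(w$1)\<^sup>2 + (w$2)\<^sup>2 = cubic j1 j2 s * ((sin \<theta>)\<^sup>2 + (cos \<theta>)\<^sup>2)"
    by (simp add: w power_mult_distrib distrib_left del: sin_cos_squared_add)
  then show "w \<in> reduced_surface j1 j2" using s by (simp add: reduced_surface_def w)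
qed

lemma cubic_nonneg_set:
  assumes "j1 \<ge> 0" "j2 \<le> j1"
  shows "{s. cubic j1 j2 s \<ge> 0} = {- j1..min j1 (- j2)} \<union> {max j1 (- j2)..}"
proof -
  define a b c where abc: "a = - j1" "b = min j1 (- j2)" "c = max j1 (- j2)"
  have le: "a \<le> b" "b \<le> c" using assms by (auto simp: abc)
  have "cubic j1 j2 s \<ge> 0 \<longleftrightarrow> (a \<le> s \<and> s \<le> b) \<or> c \<le> s" for s
    unfolding cubic_factor abc[symmetric] using le by (auto simp: zero_le_mult_iff mult_le_0_iff)
  then show ?thesis by (simp only: set_eq_iff mem_Collect_eq Un_iff atLeastAtMost_iff atLeast_iff abc simp_thms)
qed

text \<open>A fixed point has \<open>x = 0\<close> and \<open>\<pi>\<^sub>1 = \<pi>\<^sub>2 = 0\<close>, so that \<open>\<pi>\<^sub>3\<close> is both \<open>\<plusminus> j\<^sub>1\<close> and \<open>- j\<^sub>2\<close>; the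
  assumptions on \<open>j\<^sub>2\<close> exclude both signs.\<close>

lemma orbit_not_singleton:
  assumes "j1 \<ge> 0" "j2 < j1" "j2 \<noteq> - j1" "m \<in> reduced_space j1 j2"
  shows "\<not> is_singleton m"
proof
  assume "is_singleton m"
  obtain z where z: "z \<in> level_set j1 j2" "m = circle_orbit z" using assms(4) by (auto simp: reduced_space_def)
  have "circle_act pi z = z"
  proof -
    have "circle_act pi z \<in> m" using z(2) by (simp add: circle_orbit_def)
    then show ?thesis using \<open>is_singleton m\<close> circle_orbit_refl[of z] z(2) by (auto simp: is_singleton_def)
  qed
  then have "- fst z $ 1 = fst z $ 1" "- fst z $ 2 = fst z $ 2" "- snd z $ 1 = snd z $ 1" "- snd z $ 2 = snd z $ 2"
    using circle_act_nth[of pi z] by simp_all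
  then have "(snd z $ 3)\<^sup>2 = j1\<^sup>2" "j2 + snd z $ 3 = 0"
    using z(1) by (auto simp: level_set_iff[OF assms(1)])
  then have "snd z $ 3 = - j2" "snd z $ 3 = j1 \<or> snd z $ 3 = - j1" by (auto simp: power2_eq_iff)
  then show False using assms(2,3) by auto
qed

lemma homeomorphism_imp_homeomorphic_maps:
  "homeomorphism S T f g \<Longrightarrow> homeomorphic_maps (top_of_set S) (top_of_set T) f g"
  by (auto simp: homeomorphism_def homeomorphic_maps_def)

text \<open>For \<open>b < c\<close> the whole surface lies below height \<open>c\<close>, so \<^const>\<open>to_sphere\<close> restricts to a
  diffeomorphism onto the sphere that is induced from the ambient space.\<close>

lemma smooth_case:
  assumes j: "j1 > 0" "j2 < j1" "j2 \<noteq> - j1"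
  shows "\<exists>\<Phi>. homeomorphic_map (reduced_topology j1 j2) (top_of_set unit_sphere) \<Phi> \<and>
              (\<forall>m\<in>reduced_space j1 j2. orbit_diffeo_at j1 j2 \<Phi> unit_sphere m)"
    and "singular_points 2 (reduced_surface j1 j2) = {}"
    and "diffeomorphic_sets (reduced_surface j1 j2) unit_sphere"
proof -
  define a b c where abc: "a = - j1" "b = min j1 (- j2)" "c = max j1 (- j2)"
  have lt: "a < b" "b < c" using j by (auto simp: abc)
  have N: "reduced_surface j1 j2 = cubic_surface a b c"
    unfolding abc by (rule reduced_surface_eq_cubic_surface)
  note hom = homeomorphism_to_sphere[OF lt, folded N]
  have below: "w $ 3 < c" if "w \<in> reduced_surface j1 j2" for w
    using that lt unfolding N by (simp add: cubic_surface_def)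
  have below': "from_sphere a b c v $ 3 < c" if "v \<in> unit_sphere" for v
    using that hom below unfolding homeomorphism_def by blast
  have to: "smooth_within S (to_sphere a b c) w" if "w \<in> reduced_surface j1 j2" for S w
    by (rule smooth_on_imp_within[OF open_below _ smooth_on_to_sphere[OF lt(1)]]) (use below that in auto)
  have inverse_smooth: "smooth_within S (from_sphere a b c) v" if "v \<in> unit_sphere" for S v
    by (rule smooth_on_imp_within[OF open_from_sphere_below _ smooth_on_from_sphere]) (use below' that in auto)
  show "diffeomorphic_sets (reduced_surface j1 j2) unit_sphere"
    unfolding diffeomorphic_sets_def using hom to inverse_smooth by blast
  show "singular_points 2 (reduced_surface j1 j2) = {}"
    unfolding singular_points_def
    using cubic_surface_submanifold_at[OF lt(1) less_imp_le[OF lt(2)]] below N by auto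
  have transfer: "smooth_within unit_sphere g (to_sphere a b c w) \<longleftrightarrow>
      smooth_within (reduced_surface j1 j2) (g \<circ> to_sphere a b c) w"
    if w: "w \<in> reduced_surface j1 j2" for g :: "real^3 \<Rightarrow> real" and w
  proof
    assume "smooth_within unit_sphere g (to_sphere a b c w)"
    then show "smooth_within (reduced_surface j1 j2) (g \<circ> to_sphere a b c) w"
      by (rule smooth_within_compose[OF _ open_below _ smooth_on_to_sphere[OF lt(1)]])
         (use below[OF w] hom in \<open>auto simp: homeomorphism_def\<close>)
  next
    have v: "to_sphere a b c w \<in> unit_sphere" "from_sphere a b c (to_sphere a b c w) = w"
      using w hom by (auto simp: homeomorphism_def)
    assume "smooth_within (reduced_surface j1 j2) (g \<circ> to_sphere a b c) w"
    then have "smooth_within unit_sphere ((g \<circ> to_sphere a b c) \<circ> from_sphere a b c) (to_sphere a b c w)"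
      by (intro smooth_within_compose[OF _ open_from_sphere_below _ smooth_on_from_sphere])
         (use below'[OF v(1)] hom v in \<open>auto simp: homeomorphism_def\<close>)
    then show "smooth_within unit_sphere g (to_sphere a b c w)"
      by (rule smooth_within_cong_local[OF _ open_UNIV]) (use hom in \<open>auto simp: homeomorphism_def\<close>)
  qed
  show "\<exists>\<Phi>. homeomorphic_map (reduced_topology j1 j2) (top_of_set unit_sphere) \<Phi> \<and>
              (\<forall>m\<in>reduced_space j1 j2. orbit_diffeo_at j1 j2 \<Phi> unit_sphere m)"
  proof (intro exI conjI ballI)
    show "homeomorphic_map (reduced_topology j1 j2) (top_of_set unit_sphere) (to_sphere a b c \<circ> reduced_coords)"
    proof (rule homeomorphic_map_compose)
      show "homeomorphic_map (reduced_topology j1 j2) (top_of_set (reduced_surface j1 j2)) reduced_coords"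
        using reduced_coords_homeomorphic_map j(1) by simp
      show "homeomorphic_map (top_of_set (reduced_surface j1 j2)) (top_of_set unit_sphere) (to_sphere a b c)"
        using homeomorphism_imp_homeomorphic_maps[OF hom] homeomorphic_map_maps by blast
    qed
    fix m assume m: "m \<in> reduced_space j1 j2"
    then have "reduced_coords m \<in> reduced_surface j1 j2"
      using invariants_reduced_surface[of j1 _ j2] j(1) by (auto simp: reduced_space_def reduced_coords_orbit)
    then show "orbit_diffeo_at j1 j2 (to_sphere a b c \<circ> reduced_coords) unit_sphere m"
      using orbit_diffeo_reduced_coords[OF _ m orbit_not_singleton[OF _ j(2,3) m]] j(1) transfer
      by (simp add: orbit_diffeo_at_def comp_assoc)
  qed
qed

lemma reduced_space_singleton:
  assumes "j1 \<ge> 0" "j2 \<le> j1" "j1 = 0 \<or> j2 = j1"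
  shows "is_singleton (reduced_space j1 j2)"
proof -
  have "w = vector [0, 0, - j1]" if w: "w \<in> reduced_surface j1 j2" for w
  proof -
    have "w $ 3 = - j1" using assms w by (auto simp: reduced_surface_def)
    moreover from this have "(w$1)\<^sup>2 + (w$2)\<^sup>2 = 0" using reduced_surfaceD(1)[OF w] by (simp add: cubic_def)
    ultimately show ?thesis by (intro vec3_eqI) (auto simp: sum_power2_eq_zero_iff)
  qed
  moreover have "vector [0, 0, - j1] \<in> reduced_surface j1 j2"
    using assms by (auto simp: reduced_surface_def cubic_def)
  ultimately have "reduced_surface j1 j2 = {vector [0, 0, - j1]}" by blast
  moreover have "bij_betw reduced_coords (reduced_space j1 j2) (reduced_surface j1 j2)"
    using reduced_coords_homeomorphic_map[OF assms(1), of j2] quotient_imp_surjective_map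
    by (fastforce simp: homeomorphic_map_def bij_betw_def topspace_reduced_topology)
  ultimately show ?thesis
    using bij_betw_same_card by (fastforce simp: is_singleton_altdef)
qed

theorem mainTheorem6:
  fixes j1 j2 :: real
  assumes "j1 \<ge> 0"
  shows "(reduced_space j1 j2 \<noteq> {} \<longleftrightarrow> j2 \<le> j1) \<and>
    (j2 \<le> j1 \<longrightarrow>
      (\<forall>z\<in>level_set j1 j2. reduced_coords (circle_orbit z) = invariants z) \<and>
      homeomorphic_map (reduced_topology j1 j2) (top_of_set (reduced_surface j1 j2)) reduced_coords \<and>
      (\<forall>m\<in>reduced_space j1 j2. \<not> is_singleton m \<longrightarrow>
         orbit_diffeo_at j1 j2 reduced_coords (reduced_surface j1 j2) m) \<and>
      reduced_surface j1 j2 =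
        surface_of_revolution (\<lambda>s. sqrt (cubic j1 j2 s)) {- j1..min j1 (- j2)} \<and>
      {s. cubic j1 j2 s \<ge> 0} = {- j1..min j1 (- j2)} \<union> {max j1 (- j2)..} \<and>
      (j1 = 0 \<or> j2 = j1 \<longrightarrow> is_singleton (reduced_space j1 j2)) \<and>
      (j1 > 0 \<and> j2 = - j1 \<longrightarrow>
         reduced_topology j1 j2 homeomorphic_space top_of_set unit_sphere \<and>
         singular_points 2 (reduced_surface j1 j2) = {vector [0, 0, j1]} \<and>
         conical_singularity 2 (reduced_surface j1 j2) (vector [0, 0, j1]) \<and>
         (+) (vector [0, 0, j1]) ` tangent_cone (reduced_surface j1 j2) (vector [0, 0, j1]) =
           {w. sqrt ((w$1)\<^sup>2 + (w$2)\<^sup>2) = 4 * sqrt j1 * (j1 - w$3)}) \<and>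
      (j1 > 0 \<and> j2 < j1 \<and> j2 \<noteq> - j1 \<longrightarrow>
         (\<exists>\<Phi>. homeomorphic_map (reduced_topology j1 j2) (top_of_set unit_sphere) \<Phi> \<and>
              (\<forall>m\<in>reduced_space j1 j2. orbit_diffeo_at j1 j2 \<Phi> unit_sphere m)) \<and>
         singular_points 2 (reduced_surface j1 j2) = {} \<and>
         diffeomorphic_sets (reduced_surface j1 j2) unit_sphere))"
proof (intro conjI impI)
  show "reduced_space j1 j2 \<noteq> {} \<longleftrightarrow> j2 \<le> j1"
  proof
    assume "reduced_space j1 j2 \<noteq> {}"
    then obtain w where "w \<in> reduced_surface j1 j2"
      using invariants_level_set[OF assms, of j2] by (auto simp: reduced_space_def)
    then show "j2 \<le> j1" by (auto simp: reduced_surface_def)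
  next
    assume "j2 \<le> j1"
    then have "vector [0, 0, - j1] \<in> reduced_surface j1 j2"
      using assms by (simp add: reduced_surface_def cubic_def)
    then show "reduced_space j1 j2 \<noteq> {}"
      using invariants_level_set[OF assms, of j2] by (auto simp: reduced_space_def)
  qed
  assume le: "j2 \<le> j1"
  show "\<forall>z\<in>level_set j1 j2. reduced_coords (circle_orbit z) = invariants z"
    by (simp add: reduced_coords_orbit)
  show "homeomorphic_map (reduced_topology j1 j2) (top_of_set (reduced_surface j1 j2)) reduced_coords"
    by (rule reduced_coords_homeomorphic_map[OF assms])
  show "\<forall>m\<in>reduced_space j1 j2. \<not> is_singleton m \<longrightarrow>
         orbit_diffeo_at j1 j2 reduced_coords (reduced_surface j1 j2) m"
    using orbit_diffeo_reduced_coords[OF assms] by blast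
  show "reduced_surface j1 j2 =
        surface_of_revolution (\<lambda>s. sqrt (cubic j1 j2 s)) {- j1..min j1 (- j2)}"
    by (rule reduced_surface_revolution[OF le])
  show "{s. cubic j1 j2 s \<ge> 0} = {- j1..min j1 (- j2)} \<union> {max j1 (- j2)..}"
    by (rule cubic_nonneg_set[OF assms le])
  show "is_singleton (reduced_space j1 j2)" if "j1 = 0 \<or> j2 = j1"
    by (rule reduced_space_singleton[OF assms le that])
  {
    assume c: "j1 > 0 \<and> j2 = - j1"
    then have N: "reduced_surface j1 j2 = cubic_surface (- j1) j1 j1" and j: "j1 > 0"
      by (simp_all add: reduced_surface_eq_cubic_surface)
    have "reduced_topology j1 j2 homeomorphic_space top_of_set (reduced_surface j1 j2)"
      using reduced_coords_homeomorphic_map[OF assms] homeomorphic_map_imp_homeomorphic_space by blast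
    also have "top_of_set (reduced_surface j1 j2) homeomorphic_space top_of_set unit_sphere"
    proof -
      obtain f g where "homeomorphism unit_sphere (cubic_surface (- j1) j1 j1) f g"
        using homeomorphic_sphere_cubic_surface[of "- j1" j1 j1] j by (auto simp: homeomorphic_def)
      then show ?thesis
        unfolding N using homeomorphism_imp_homeomorphic_maps homeomorphic_space_def homeomorphic_space_sym by blast
    qed
    finally (homeomorphic_space_trans) show "reduced_topology j1 j2 homeomorphic_space top_of_set unit_sphere" .
    show "singular_points 2 (reduced_surface j1 j2) = {vector [0, 0, j1]}"
      unfolding N by (rule singular_points_pinched[OF j])
    show "conical_singularity 2 (reduced_surface j1 j2) (vector [0, 0, j1])"
      unfolding N by (rule conical_singularity_pinched[OF j])
    show "(+) (vector [0, 0, j1]) ` tangent_cone (reduced_surface j1 j2) (vector [0, 0, j1]) =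
           {w. sqrt ((w$1)\<^sup>2 + (w$2)\<^sup>2) = 4 * sqrt j1 * (j1 - w$3)}"
      unfolding N translated_tangent_cone_apex[OF j] by (rule apex_cone_def)
  }
  {
    assume c: "j1 > 0 \<and> j2 < j1 \<and> j2 \<noteq> - j1"
    show "\<exists>\<Phi>. homeomorphic_map (reduced_topology j1 j2) (top_of_set unit_sphere) \<Phi> \<and>
              (\<forall>m\<in>reduced_space j1 j2. orbit_diffeo_at j1 j2 \<Phi> unit_sphere m)"
      using smooth_case(1) c by blast
    show "singular_points 2 (reduced_surface j1 j2) = {}" using smooth_case(2) c by blast
    show "diffeomorphic_sets (reduced_surface j1 j2) unit_sphere" using smooth_case(3) c by blast
  }
qed

end
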